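(* Let $K$ be any field and let $\underline{h} = (1,h_1,\dots,h_s)$ be a finite sequence of positive integers. Then $\underline{h}$ is the Hilbert function of a graded Artinian $K$-algebra $R/J$ (with $R$ a standard graded polynomial ring over $K$ in finitely many variables and $J$ a homogeneous ideal) having the Weak Lefschetz property if and only if $\underline{h}$ is a unimodal O-sequence such that the positive part of its first difference is an O-sequence. Furthermore, let $\underline{h}$ satisfy these conditions, let $R = K[x_0,\dots,x_n]$ with $h_1 \le n+1$, let $u_1,\dots,u_\ell$ and $\Phi_{\underline{h}}(\lambda)$ be as defined in the context, and let $A = R/I$ be any algebra obtained by the construction described in the context. Then $A$ has the Weak Lefschetz property, Hilbert function $\underline{h}$, and maximal socle type, i.e. its socle type is $\Phi_{\underline{h}}(\lambda)$.
   Context: A standard graded Artinian $K$-algebra $A = \bigoplus_{i\ge 0} A_i$ has the Weak Lefschetz property if there is $g \in A_1$ such that $\times g : A_i \to A_{i+1}$ has maximal rank for every $i$. The Hilbert function of $A$ is $h_A(t) = \dim_K A_t$. An O-sequence is a sequence that is the Hilbert function of some standard graded $K$-algebra (equivalently, satisfies Macaulay's growth bound). Put $h_0 = 1$, $h_{-1}=0$, $h_{s+1} = 0$. The positive part of the first difference of $\underline h$ is $\bar h(j) := \max\{h_j - h_{j-1}, 0\}$. If $\underline{h}$ is unimodal and $\bar h$ is an O-sequence, there are integers $u_1 < u_2 < \dots < u_\ell$ with $$h_0<h_1<\cdots<h_{u_1}=\cdots=h_{u_2-1}>h_{u_2}=\cdots=h_{u_3-1}>h_{u_3}=\cdots>h_{u_\ell}=\cdots=h_s>0.$$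 Define $\Phi_{\underline{h}}(\lambda) := \sum_{i=u_1}^{s}(h_i-h_{i+1})\lambda^i$. The socle type of $A$ is $S(A,\lambda) = \sum_i a_i \lambda^i$, where $a_i = \dim_K [\operatorname{Soc}(A)]_i$ and $\operatorname{Soc}(A)$ is the annihilator in $A$ of the homogeneous maximal ideal. Construction: let $\bar R := K[x_1,\dots,x_n]$. Choose homogeneous Artinian ideals $\bar J_1 \subset \bar J_2 \subset \dots \subset \bar J_\ell \subset \bar R$ such that $\bar R/\bar J_1$ has Hilbert function $\bar h$ and $\deg \bar J_i := \dim_K \bar R/\bar J_i = h_{u_i}$ for $i = 2,\dots,\ell$. Put $J_i = \bar J_i R$ for $i=1,\dots,\ell$ and $$I := J_1 + \sum_{i=2}^{\ell} [J_i]_{\ge u_i} + \mathfrak{m}^{s+1}, \qquad \mathfrak m = (x_0,\dots,x_n),$$ where $[J_i]_{\ge u_i} = \bigoplus_{t\ge u_i}[J_i]_t$. Set $A := R/I$. *)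

theory Defs
  imports
    "HOL-Algebra.Algebra"
    "HOL-Library.Poly_Mapping"
    "HOL-Computational_Algebra.Polynomial"
begin

section \<open>Polynomial rings and their grading\<close>

text \<open>Polynomials in variables \<open>x\<^sub>0, x\<^sub>1, \<dots>\<close>: finitely supported maps from exponent vectors to
  coefficients. Every polynomial ring below is the subring on a set \<open>V\<close> of variables, so that
  \<open>K[x\<^sub>1,\<dots>,x\<^sub>n]\<close> is literally contained in \<open>K[x\<^sub>0,\<dots>,x\<^sub>n]\<close>.\<close>

type_synonym 'k mpoly = "(nat \<Rightarrow>\<^sub>0 nat) \<Rightarrow>\<^sub>0 'k"

definition polys :: "nat set \<Rightarrow> 'k::field mpoly ring" where
  "polys V = \<lparr>carrier = {p. \<forall>m \<in> Poly_Mapping.keys p. Poly_Mapping.keys m \<subseteq> V},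
     monoid.mult = (*), one = 1, ring.zero = 0, add = (+)\<rparr>"

definition const :: "'k::field \<Rightarrow> 'k mpoly" where
  "const c = Poly_Mapping.single 0 c"

definition var :: "nat \<Rightarrow> 'k::field mpoly" where
  "var i = Poly_Mapping.single (Poly_Mapping.single i 1) 1"

definition mdeg :: "(nat \<Rightarrow>\<^sub>0 nat) \<Rightarrow> nat" where
  "mdeg m = (\<Sum>i \<in> Poly_Mapping.keys m. Poly_Mapping.lookup m i)"

definition forms :: "nat set \<Rightarrow> nat \<Rightarrow> 'k::field mpoly set" where
  "forms V t = {p \<in> carrier (polys V). \<forall>m \<in> Poly_Mapping.keys p. mdeg m = t}"

definition hcomp :: "nat \<Rightarrow> 'k::field mpoly \<Rightarrow> 'k mpoly" where
  "hcomp t p = (\<Sum>m | m \<in> Poly_Mapping.keys p \<and> mdeg m = t.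
     Poly_Mapping.single m (Poly_Mapping.lookup p m))"

definition homogeneous_ideal :: "nat set \<Rightarrow> 'k::field mpoly set \<Rightarrow> bool" where
  "homogeneous_ideal V J \<longleftrightarrow> ideal J (polys V) \<and> (\<forall>p \<in> J. \<forall>t. hcomp t p \<in> J)"

text \<open>The direct sum of the \<open>[J]\<^sub>t\<close> over \<open>t \<ge> u\<close>, described through homogeneous components.\<close>

definition ideal_from_degree :: "nat set \<Rightarrow> 'k::field mpoly set \<Rightarrow> nat \<Rightarrow> 'k mpoly set" where
  "ideal_from_degree V J u =
     {p \<in> carrier (polys V). \<forall>t. hcomp t p \<in> (if u \<le> t then J \<inter> forms V t else {0})}"

definition irrelevant_ideal :: "nat set \<Rightarrow> 'k::field mpoly set" where
  "irrelevant_ideal V = Idl\<^bsub>polys V\<^esub> (var ` V)"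


section \<open>Graded quotients\<close>

text \<open>Standard graded \<open>K\<close>-algebras are presented as \<open>polys V Quot J\<close> with \<open>V\<close> finite and \<open>J\<close> a
  proper homogeneous ideal.\<close>

abbreviation residue :: "nat set \<Rightarrow> 'k::field mpoly set \<Rightarrow> 'k mpoly \<Rightarrow> 'k mpoly set" where
  "residue V J p \<equiv> J +>\<^bsub>polys V\<^esub> p"

definition degree_piece :: "nat set \<Rightarrow> 'k::field mpoly set \<Rightarrow> nat \<Rightarrow> 'k mpoly set set" where
  "degree_piece V J t = residue V J ` forms V t"

text \<open>Dimension over \<open>K\<close>, where \<open>K\<close> is embedded in the quotient as the residues of constants.\<close>

definition kdim :: "nat set \<Rightarrow> 'k::field mpoly set \<Rightarrow> 'k mpoly set set \<Rightarrow> nat" where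
  "kdim V J E = (ring.dim (polys V Quot J) over (residue V J ` range const)) E"

definition hilbert_function :: "nat set \<Rightarrow> 'k::field mpoly set \<Rightarrow> nat \<Rightarrow> nat" where
  "hilbert_function V J t = kdim V J (degree_piece V J t)"

definition artinian_ring :: "('a, 'b) ring_scheme \<Rightarrow> bool" where
  "artinian_ring A \<longleftrightarrow>
     (\<forall>C :: nat \<Rightarrow> 'a set. (\<forall>i. ideal (C i) A) \<and> (\<forall>i. C (Suc i) \<subseteq> C i)
        \<longrightarrow> (\<exists>N. \<forall>i \<ge> N. C i = C N))"

definition homogeneous_artinian_ideal :: "nat set \<Rightarrow> 'k::field mpoly set \<Rightarrow> bool" where
  "homogeneous_artinian_ideal V J \<longleftrightarrow>
     homogeneous_ideal V J \<and> artinian_ring (polys V Quot J)"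

text \<open>Maximal rank: the rank of \<open>\<times>g : A\<^sub>i \<rightarrow> A\<^sub>i\<^sub>+\<^sub>1\<close> is the smaller of the two dimensions.\<close>

definition weak_lefschetz :: "nat set \<Rightarrow> 'k::field mpoly set \<Rightarrow> bool" where
  "weak_lefschetz V J \<longleftrightarrow>
     (\<exists>g \<in> degree_piece V J 1. \<forall>i.
        kdim V J ((\<lambda>a. g \<otimes>\<^bsub>polys V Quot J\<^esub> a) ` degree_piece V J i)
          = min (hilbert_function V J i) (hilbert_function V J (i + 1)))"

definition socle :: "nat set \<Rightarrow> 'k::field mpoly set \<Rightarrow> 'k mpoly set set" where
  "socle V J = {a \<in> carrier (polys V Quot J).
     \<forall>b \<in> residue V J ` irrelevant_ideal V. b \<otimes>\<^bsub>polys V Quot J\<^esub> a = \<zero>\<^bsub>polys V Quot J\<^esub>}"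

definition socle_dim :: "nat set \<Rightarrow> 'k::field mpoly set \<Rightarrow> nat \<Rightarrow> nat" where
  "socle_dim V J i = kdim V J (socle V J \<inter> degree_piece V J i)"

definition socle_type :: "nat set \<Rightarrow> 'k::field mpoly set \<Rightarrow> int poly" where
  "socle_type V J = (\<Sum>i | socle_dim V J i \<noteq> 0. Polynomial.monom (int (socle_dim V J i)) i)"


section \<open>Sequences\<close>

text \<open>A finite sequence \<open>(1,h\<^sub>1,\<dots>,h\<^sub>s)\<close> of positive integers, continued by \<open>0\<close> beyond \<open>s\<close>.\<close>

definition finite_sequence :: "nat \<Rightarrow> (nat \<Rightarrow> nat) \<Rightarrow> bool" where
  "finite_sequence s h \<longleftrightarrow> h 0 = 1 \<and> (\<forall>i \<le> s. 0 < h i) \<and> (\<forall>i > s. h i = 0)"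

definition unimodal :: "nat \<Rightarrow> (nat \<Rightarrow> nat) \<Rightarrow> bool" where
  "unimodal s h \<longleftrightarrow> (\<exists>k \<le> s. mono_on {..k} h \<and> antimono_on {k..s} h)"

definition O_sequence :: "'k::field itself \<Rightarrow> (nat \<Rightarrow> nat) \<Rightarrow> bool" where
  "O_sequence _ h \<longleftrightarrow>
     (\<exists>V (J :: 'k mpoly set). finite V \<and> homogeneous_ideal V J \<and> J \<noteq> carrier (polys V)
        \<and> hilbert_function V J = h)"

text \<open>Subtraction on \<open>nat\<close> is truncated, so this is \<open>max {h\<^sub>j - h\<^sub>j\<^sub>-\<^sub>1, 0}\<close> with \<open>h\<^sub>-\<^sub>1 = 0\<close>.\<close>

definition pos_diff :: "(nat \<Rightarrow> nat) \<Rightarrow> nat \<Rightarrow> nat" where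
  "pos_diff h j = h j - (case j of 0 \<Rightarrow> 0 | Suc i \<Rightarrow> h i)"

text \<open>\<open>h\<^sub>0 < \<dots> < h\<^bsub>u\<^sub>1\<^esub> = \<dots> = h\<^bsub>u\<^sub>2-1\<^esub> > h\<^bsub>u\<^sub>2\<^esub> = \<dots> = h\<^bsub>u\<^sub>3-1\<^esub> > \<dots> > h\<^bsub>u\<^sub>l\<^esub> = \<dots> = h\<^sub>s > 0\<close>;
  the values of \<open>u\<close> outside \<open>{1..l}\<close> are irrelevant.\<close>

definition plateau_indices :: "nat \<Rightarrow> (nat \<Rightarrow> nat) \<Rightarrow> nat \<Rightarrow> (nat \<Rightarrow> nat) \<Rightarrow> bool" where
  "plateau_indices s h l u \<longleftrightarrow>
     1 \<le> l \<and> (\<forall>i \<in> {1..<l}. u i < u (i + 1)) \<and> u l \<le> s \<and>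
     (\<forall>j < u 1. h j < h (j + 1)) \<and>
     (\<forall>i \<in> {1..<l}. (\<forall>j \<in> {u i..u (i + 1) - 1}. h j = h (u i)) \<and>
        h (u (i + 1) - 1) > h (u (i + 1))) \<and>
     (\<forall>j \<in> {u l..s}. h j = h (u l)) \<and> h s > 0"

definition Phi :: "nat \<Rightarrow> (nat \<Rightarrow> nat) \<Rightarrow> nat \<Rightarrow> int poly" where
  "Phi s h u1 = (\<Sum>i = u1..s. Polynomial.monom (int (h i) - int (h (i + 1))) i)"


section \<open>The construction\<close>

text \<open>Strictness of the inclusions is forced by the dimensions.\<close>

definition ideal_chain ::
  "nat \<Rightarrow> (nat \<Rightarrow> nat) \<Rightarrow> nat \<Rightarrow> (nat \<Rightarrow> nat) \<Rightarrow> (nat \<Rightarrow> 'k::field mpoly set) \<Rightarrow> bool" where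
  "ideal_chain n h l u Jb \<longleftrightarrow>
     (\<forall>i \<in> {1..l}. homogeneous_artinian_ideal {1..n} (Jb i)) \<and>
     (\<forall>i \<in> {1..<l}. Jb i \<subseteq> Jb (i + 1)) \<and>
     hilbert_function {1..n} (Jb 1) = pos_diff h \<and>
     (\<forall>i \<in> {2..l}. kdim {1..n} (Jb i) (carrier (polys {1..n} Quot Jb i)) = h (u i))"

text \<open>Sums and powers of ideals are taken in the semiring of ideals of \<open>K[x\<^sub>0,\<dots>,x\<^sub>n]\<close>.\<close>

definition constructed_ideal ::
  "nat \<Rightarrow> nat \<Rightarrow> nat \<Rightarrow> (nat \<Rightarrow> nat) \<Rightarrow> (nat \<Rightarrow> 'k::field mpoly set) \<Rightarrow> 'k mpoly set" where
  "constructed_ideal n s l u Jb =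
    (let V = {0..n}; S = ideals_set (polys V); J = (\<lambda>i. Idl\<^bsub>polys V\<^esub> (Jb i))
     in J 1 \<oplus>\<^bsub>S\<^esub> (\<Oplus>\<^bsub>S\<^esub> i \<in> {2..l}. ideal_from_degree V (J i) (u i))
          \<oplus>\<^bsub>S\<^esub> irrelevant_ideal V [^]\<^bsub>S\<^esub> (s + 1))"

end

theory Submission
  imports Defs
begin

text \<open>Setting one variable \<open>v\<close> to \<open>1\<close> identifies the forms of degree \<open>t\<close> in \<open>K[v, W]\<close> with the
  polynomials of degree at most \<open>t\<close> in \<open>K[W]\<close>, and multiplication by \<open>v\<close> becomes the inclusion of
  degree at most \<open>t\<close> into degree at most \<open>t + 1\<close>. An increasing family of ideals \<open>D\<^sub>t\<close> of \<open>K[W]\<close> thus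
  defines an ideal \<open>I\<close> of \<open>K[v, W]\<close> whose quotient has \<open>K[W]\<^bsub>\<le>t\<^esub> / D\<^sub>t\<close> in degree \<open>t\<close>. If \<open>D\<^sub>t\<close> is
  constant up to the peak \<open>k\<close> of \<open>h\<close> and contains all forms of degree above \<open>k\<close>, then \<open>\<times>v\<close> is
  injective before \<open>k\<close> and surjective from \<open>k\<close> on, and an element of degree \<open>t\<close> lies in the socle
  exactly if it is killed by \<open>v\<close>, that is, comes from \<open>D\<^bsub>t+1\<^esub>\<close>. The ideal of the construction is of
  this kind, with \<open>D\<^sub>t\<close> the ideal belonging to the plateau of \<open>t\<close>; for the existence statement, \<open>D\<^sub>t\<close>
  is obtained by adjoining forms of maximal degree one at a time. Conversely, factoring out a
  Lefschetz element leaves an algebra with Hilbert function \<open>pos_diff h\<close>; it is generated in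
  degree one, so once \<open>h\<close> stops growing it never grows again.\<close>

text \<open>\<open>kdim\<close> is a dimension inside a factor ring over the image of the constants.
  \<open>kdim_residue\<close> turns it into \<open>rdim J U\<close>, the dimension of
  \<open>U\<close> modulo \<open>J\<close> in the one K-space of all polynomials, and dimension
  counts then take place among polynomials. That space is infinite-dimensional, so finiteness is
  recorded for each subspace by \<open>findim\<close>. The numbers agree for two reasons. Up to the
  peak k, D_t is a homogeneous ideal with Hilbert function \<open>pos_diff h\<close>; the dimension
  of the polynomials of degree at most t modulo it is a sum of differences that telescopes to h_t.
  Beyond the peak \<open>pos_diff h\<close> vanishes, so all forms of degree above k lie in D_0
  already. Hence the polynomials of degree at most k represent all of K[W]/D_t, and only the total
  dimension h_t of that quotient matters. This is why the construction prescribes a Hilbert function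
  for the first ideal and merely a degree for the later ones. The socle is the kernel of
  multiplication by v because a form killed by v dehomogenizes into the ideal D_{t+1}, which absorbs
  all other variables as well. Its dimension in degree t is therefore h_t - min(h_t,
  h_{t+1}).\<close>

section \<open>Dimension modulo a subspace\<close>

text \<open>The dimension of the image of \<open>U\<close> in the quotient by \<open>J\<close>,
  written without a quotient space. It has this meaning for finite-dimensional
  \<open>U\<close>.\<close>

definition (in vector_space) rdim :: "'b set \<Rightarrow> 'b set \<Rightarrow> nat" where
  "rdim J U = dim U - dim (U \<inter> J)"

definition (in vector_space) findim :: "'b set \<Rightarrow> bool" where
  "findim U \<longleftrightarrow> subspace U \<and> (\<exists>B. finite B \<and> U \<subseteq> span B)"

text \<open>Such a \<open>C\<close> lifts a basis of \<open>U\<close> modulo \<open>J\<close> to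
  \<open>U\<close>.\<close>

definition (in vector_space) rbasis :: "'b set \<Rightarrow> 'b set \<Rightarrow> 'b set \<Rightarrow> bool" where
  "rbasis J U C \<longleftrightarrow> finite C \<and> C \<subseteq> U \<and> independent C \<and> span C \<inter> J \<subseteq> {0}
     \<and> (\<forall>x\<in>U. \<exists>c\<in>span C. x - c \<in> J)"

context vector_space begin

lemma findim_subset: "findim W \<Longrightarrow> subspace U \<Longrightarrow> U \<subseteq> W \<Longrightarrow> findim U"
  unfolding findim_def by blast

lemma findim_subspace: "findim U \<Longrightarrow> subspace U"
  by (simp add: findim_def)

lemma findim_basis:
  assumes "findim U"
  obtains B where "finite B" "B \<subseteq> U" "independent B" "span B = U" "card B = dim U"
proof -
  obtain B where B: "B \<subseteq> U" "independent B" "U \<subseteq> span B" "card B = dim U"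
    using basis_exists by blast
  obtain T where "finite T" "U \<subseteq> span T" using assms findim_def by auto
  then have "finite B" using independent_span_bound[of T B] B by auto
  moreover have "span B = U"
    using B findim_subspace[OF assms] span_minimal by (simp add: subset_antisym)
  ultimately show ?thesis using B that by blast
qed

lemma findim_eqI:
  assumes "findim W" "U \<subseteq> W" "subspace U" "dim W \<le> dim U"
  shows "U = W"
proof (rule ccontr)
  assume "U \<noteq> W"
  then obtain x where x: "x \<in> W" "x \<notin> U" using assms by auto
  have fU: "findim U" using findim_subset assms by blast
  obtain B where B: "finite B" "B \<subseteq> U" "independent B" "span B = U" "card B = dim U"
    using findim_basis[OF fU] .
  obtain C where C: "finite C" "C \<subseteq> W" "independent C" "span C = W" "card C = dim W"
    using findim_basis[OF assms(1)] .
  have "independent (insert x B)" using x B by (simp add: independent_insertI)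
  moreover have "insert x B \<subseteq> span C" using x B C assms by auto
  ultimately have "card (insert x B) \<le> card C" using independent_span_bound C by blast
  moreover have "x \<notin> B" using x B by auto
  ultimately show False using B C assms by simp
qed

text \<open>If the next vector \<open>c\<close> equalled \<open>a + d\<close> with \<open>a\<close>
  in \<open>span A\<close> and \<open>d\<close> in \<open>span C\<close>, then
  \<open>a = c - d\<close> would lie in both spans and vanish, so \<open>c\<close> would depend on
  \<open>C\<close>.\<close>

lemma independent_Un:
  assumes "finite C" "independent A" "independent C" "span A \<inter> span C \<subseteq> {0}"
  shows "independent (A \<union> C)"
  using assms
proof (induction C)
  case empty then show ?case by simp
next
  case (insert c C)
  have i: "independent C" "c \<notin> span C"
    using insert.prems insert.hyps by (auto simp: independent_insert)
  have sub: "span C \<subseteq> span (insert c C)" by (rule span_mono) auto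
  have "c \<notin> span (A \<union> C)"
  proof
    assume "c \<in> span (A \<union> C)"
    then obtain a d where ad: "a \<in> span A" "d \<in> span C" "c = a + d"
      by (auto simp: span_Un)
    have "c - d \<in> span (insert c C)"
      using ad(2) sub span_base[of c "insert c C"] by (intro span_diff) auto
    then have "a \<in> span (insert c C)" using ad(3) by simp
    then have "a = 0" using insert.prems(3) ad(1) by blast
    then show False using ad i by simp
  qed
  moreover have "independent (A \<union> C)" using insert i sub by auto
  ultimately show ?case by (simp add: independent_insertI)
qed

text \<open>Extend a basis \<open>B\<close> of the intersection of \<open>U\<close> and
  \<open>J\<close> to a basis \<open>E\<close> of \<open>U\<close>; the added vectors form
  \<open>C\<close>.\<close>

lemma rbasis_exists:
  assumes "findim U" "subspace J"
  obtains C where "rbasis J U C"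
proof -
  have sU: "subspace U" using assms findim_subspace by simp
  have fUJ: "findim (U \<inter> J)"
    by (rule findim_subset[OF assms(1) subspace_inter[OF sU assms(2)]]) simp
  obtain B where B: "finite B" "B \<subseteq> U \<inter> J" "independent B" "span B = U \<inter> J" "card B = dim (U \<inter> J)"
    using findim_basis[OF fUJ] .
  obtain E where E: "B \<subseteq> E" "E \<subseteq> U" "independent E" "U \<subseteq> span E"
    using maximal_independent_subset_extend[of B U] B by blast
  obtain T where "finite T" "U \<subseteq> span T" using assms findim_def by auto
  then have fE: "finite E" using independent_span_bound[of T E] E by auto
  define C where "C = E - B"
  have EBC: "E = B \<union> C" "B \<inter> C = {}" using C_def E by auto
  have iC: "independent C" using E C_def independent_mono by blast
  have CU: "span C \<subseteq> U" using E C_def sU by (intro span_minimal) auto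
  \<comment> \<open>The representation of \<open>x\<close> over \<open>E\<close> is supported in
    \<open>B\<close> and in \<open>C\<close>, which are disjoint.\<close>
  have "x = 0" if x: "x \<in> span C" "x \<in> span B" for x
  proof (rule ccontr)
    assume nz: "x \<noteq> 0"
    have B_E: "representation E x b = representation B x b" for b
      using representation_extend[of E x B] x E by metis
    have C_E: "representation E x b = representation C x b" for b
      using representation_extend[of E x C] x E EBC by (metis Un_upper2)
    have "representation E x b = 0" for b
      using B_E C_E representation_ne_zero EBC by (metis disjoint_iff)
    then show False
      using sum_nonzero_representation_eq[of E x] E x nz CU by auto
  qed
  then have "span C \<inter> J \<subseteq> {0}" using CU B by auto
  moreover have "\<exists>c\<in>span C. x - c \<in> J" if "x \<in> U" for x
  proof -
    have "x \<in> span (B \<union> C)" using that E EBC by auto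
    then obtain b c where "b \<in> span B" "c \<in> span C" "x = b + c" by (auto simp: span_Un)
    then show ?thesis using B by (intro bexI[of _ c]) auto
  qed
  ultimately have "rbasis J U C"
    using fE C_def iC E unfolding rbasis_def by auto
  then show ?thesis using that by blast
qed

text \<open>A basis of the part inside \<open>J\<close> together with \<open>C\<close> is a basis of
  \<open>U\<close>. Hence the size of \<open>C\<close> depends on \<open>U\<close> and
  \<open>J\<close> only.\<close>

lemma rbasis_dim:
  assumes "findim U" "subspace J" "rbasis J U C"
  shows "dim U = card C + dim (U \<inter> J)"
proof -
  have sU: "subspace U" using assms findim_subspace by simp
  have fUJ: "findim (U \<inter> J)"
    by (rule findim_subset[OF assms(1) subspace_inter[OF sU assms(2)]]) simp
  obtain B where B: "finite B" "B \<subseteq> U \<inter> J" "independent B" "span B = U \<inter> J" "card B = dim (U \<inter> J)"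
    using findim_basis[OF fUJ] .
  have C: "finite C" "C \<subseteq> U" "independent C" "span C \<inter> J \<subseteq> {0}" 
    "\<And>x. x \<in> U \<Longrightarrow> \<exists>c\<in>span C. x - c \<in> J"
    using assms(3) unfolding rbasis_def by auto
  have CU: "span C \<subseteq> U" using C sU by (intro span_minimal) auto
  have ind: "independent (B \<union> C)" using B C by (intro independent_Un) auto
  have "c \<notin> B" if "c \<in> C" for c
  proof
    assume "c \<in> B"
    then have "c \<in> span C \<inter> J" using that B span_base by auto
    then have "c = 0" using C by auto
    then show False using that C dependent_zero by blast
  qed
  then have disj: "B \<inter> C = {}" by auto
  have "U \<subseteq> span (B \<union> C)"
  proof
    fix x assume x: "x \<in> U"
    then obtain c where c: "c \<in> span C" "x - c \<in> J" using C by blast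
    then have "x - c \<in> span B" using B x CU sU by (auto intro: subspace_diff)
    then show "x \<in> span (B \<union> C)" using c unfolding span_Un
      by (metis (mono_tags, lifting) diff_add_cancel mem_Collect_eq)
  qed
  then have "card (B \<union> C) = dim U"
    using ind B C by (intro basis_card_eq_dim) auto
  then show ?thesis using disj B C by (simp add: card_Un_disjoint)
qed

lemma rbasis_rdim: "findim U \<Longrightarrow> subspace J \<Longrightarrow> rbasis J U C \<Longrightarrow> rdim J U = card C"
  using rbasis_dim rdim_def by simp

lemma dim_eq_rdim_add: "findim U \<Longrightarrow> subspace J \<Longrightarrow> dim U = rdim J U + dim (U \<inter> J)"
  using rbasis_dim rbasis_rdim rbasis_exists by metis

text \<open>Both spaces have the same image modulo \<open>J\<close>. This later allows polynomials
  of high degree to be replaced by ones of low degree.\<close>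

lemma rdim_eqI:
  assumes "findim W" "subspace J" "subspace U" "U \<subseteq> W" "\<And>x. x \<in> W \<Longrightarrow> \<exists>y\<in>U. x - y \<in> J"
  shows "rdim J U = rdim J W"
proof -
  have fU: "findim U" using assms findim_subset by blast
  obtain C where C: "rbasis J U C" using rbasis_exists[OF fU assms(2)] .
  have "\<exists>c\<in>span C. x - c \<in> J" if xW: "x \<in> W" for x
  proof -
    obtain y where y: "y \<in> U" "x - y \<in> J" using xW assms(5) by blast
    then obtain c where c: "c \<in> span C" "y - c \<in> J" using C unfolding rbasis_def by blast
    have "(x - y) + (y - c) \<in> J" using y c assms(2) subspace_add by blast
    then show ?thesis using c by auto
  qed
  then have "rbasis J W C" using C assms(4) unfolding rbasis_def by auto
  then show ?thesis using rbasis_rdim C fU assms by metis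
qed

lemma findim_sum:
  assumes "findim S" "findim T"
  shows "findim {x + y |x y. x \<in> S \<and> y \<in> T}"
proof -
  obtain A where A: "finite A" "A \<subseteq> S" "independent A" "span A = S" "card A = dim S"
    using findim_basis[OF assms(1)] .
  obtain B where B: "finite B" "B \<subseteq> T" "independent B" "span B = T" "card B = dim T"
    using findim_basis[OF assms(2)] .
  have "{x + y |x y. x \<in> S \<and> y \<in> T} = span (A \<union> B)" using A B by (auto simp: span_Un)
  then show ?thesis unfolding findim_def using A B by (metis finite_Un order_refl subspace_span)
qed

text \<open>The dimension formula, from the second isomorphism theorem: \<open>S\<close> and the sum
  have the same image modulo \<open>T\<close>.\<close>

lemma dim_sum:
  assumes "findim S" "findim T"
  shows "dim {x + y |x y. x \<in> S \<and> y \<in> T} + dim (S \<inter> T) = dim S + dim T"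
proof -
  let ?P = "{x + y |x y. x \<in> S \<and> y \<in> T}"
  have s: "subspace S" "subspace T" using assms findim_subspace by auto
  have S: "S \<subseteq> ?P" "T \<subseteq> ?P" using subspace_0[OF s(1)] subspace_0[OF s(2)] by force+
  have "rdim T S = rdim T ?P"
  proof (rule rdim_eqI[OF findim_sum[OF assms] s(2) s(1) S(1)])
    fix x assume "x \<in> ?P"
    then obtain a b where "x = a + b" "a \<in> S" "b \<in> T" by blast
    then show "\<exists>y\<in>S. x - y \<in> T" by (intro bexI[of _ a]) auto
  qed
  moreover have "?P \<inter> T = T" using S by auto
  ultimately show ?thesis
    using dim_eq_rdim_add[OF assms(1) s(2)] dim_eq_rdim_add[OF findim_sum[OF assms] s(2)] by simp
qed

lemma dim_image_inj:
  assumes "Vector_Spaces.linear scale scale f" "inj_on f U" "findim U"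
  shows "dim (f ` U) = dim U"
proof -
  interpret vector_space_pair scale scale by unfold_locales
  obtain B where B: "finite B" "B \<subseteq> U" "independent B" "span B = U" "card B = dim U"
    using findim_basis[OF assms(3)] .
  have "independent (f ` B)"
    using linear_independent_injective_image[OF assms(1)] B assms(2) by blast
  moreover have "span (f ` B) = f ` U" using linear_span_image assms(1) B by metis
  moreover have "card (f ` B) = card B" using B assms by (metis card_image inj_on_subset)
  ultimately show ?thesis using B dim_span_eq_card_independent by metis
qed

lemma findim_image:
  assumes "Vector_Spaces.linear scale scale f" "findim U"
  shows "findim (f ` U)"
proof -
  interpret vector_space_pair scale scale by unfold_locales
  obtain B where B: "finite B" "B \<subseteq> U" "independent B" "span B = U" "card B = dim U"
    using findim_basis[OF assms(2)] .
  then show ?thesis unfolding findim_def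
    by (metis assms(1) finite_imageI linear_span_image order_refl subspace_span)
qed

lemma rdim_eq_0_iff:
  assumes "findim U" "subspace J"
  shows "rdim J U = 0 \<longleftrightarrow> U \<subseteq> J"
proof
  assume "rdim J U = 0"
  then have "U \<inter> J = U"
    using dim_eq_rdim_add[OF assms] findim_subspace[OF assms(1)] assms(2)
    by (intro findim_eqI[OF assms(1)] subspace_inter) auto
  then show "U \<subseteq> J" by blast
qed (simp add: rdim_def Int_absorb2)

text \<open>By \<open>split\<close>, \<open>J\<close> meets the sum in the sum of its intersections
  with \<open>S\<close> and \<open>T\<close>, so the quotient decomposes too. For a homogeneous
  ideal and pieces of different degrees this condition holds.\<close>

lemma rdim_direct_sum:
  assumes "findim S" "findim T" "subspace J" "S \<inter> T = {0}"
    and split: "\<And>a b. a \<in> S \<Longrightarrow> b \<in> T \<Longrightarrow> a + b \<in> J \<Longrightarrow> a \<in> J"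
  shows "rdim J {a + b |a b. a \<in> S \<and> b \<in> T} = rdim J S + rdim J T"
proof -
  define P where "P = {a + b |a b. a \<in> S \<and> b \<in> T}"
  define Q where "Q = {a + b |a b. a \<in> S \<inter> J \<and> b \<in> T \<inter> J}"
  have s: "subspace (S \<inter> J)" "subspace (T \<inter> J)"
    using assms findim_subspace subspace_inter by simp_all
  have f: "findim (S \<inter> J)" "findim (T \<inter> J)"
    using findim_subset[OF assms(1) s(1)] findim_subset[OF assms(2) s(2)] by simp_all
  have PQ: "P \<inter> J = Q"
  proof (intro equalityI subsetI)
    fix x assume "x \<in> P \<inter> J"
    then obtain a b where x: "x = a + b" "a \<in> S" "b \<in> T" "a + b \<in> J" by (auto simp: P_def)
    then have "a \<in> J" using split by blast
    moreover from this have "b \<in> J" using subspace_diff[OF assms(3) x(4), of a] by simp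
    ultimately show "x \<in> Q" using x unfolding Q_def by blast
  next
    fix x assume "x \<in> Q"
    then obtain a b where "x = a + b" "a \<in> S" "b \<in> T" "a \<in> J" "b \<in> J" unfolding Q_def by blast
    then show "x \<in> P \<inter> J" using subspace_add[OF assms(3), of a b] unfolding P_def by blast
  qed
  have z: "dim {0} = 0" using dim_le_card[of "{0}" "{}"] by simp
  have "S \<inter> J \<inter> (T \<inter> J) = {0}" using assms(4) subspace_0[OF assms(3)] by auto
  then have "dim Q = dim (S \<inter> J) + dim (T \<inter> J)" using dim_sum[OF f] z by (simp add: Q_def)
  moreover have "dim P = dim S + dim T" using dim_sum[OF assms(1,2)] z assms(4) by (simp add: P_def)
  moreover have "dim P = rdim J P + dim Q"
    using dim_eq_rdim_add[OF findim_sum[OF assms(1,2)] assms(3)] PQ by (simp add: P_def)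
  ultimately have "rdim J P = rdim J S + rdim J T"
    using dim_eq_rdim_add[OF assms(1,3)] dim_eq_rdim_add[OF assms(2,3)] by linarith
  then show ?thesis by (simp add: P_def)
qed

text \<open>The left side is the dimension of the kernel of the surjection from \<open>P\<close>
  modulo \<open>A\<close> onto \<open>P\<close> modulo \<open>B\<close>. The socle will appear as
  such a kernel.\<close>

lemma rdim_Int_mono:
  assumes "findim P" "subspace A" "subspace B" "A \<subseteq> B"
  shows "rdim A (P \<inter> B) = rdim A P - rdim B P"
proof -
  have "P \<inter> B \<inter> A = P \<inter> A" using assms by auto
  moreover have "dim (P \<inter> A) \<le> dim P" "dim (P \<inter> B) \<le> dim P"
    using dim_eq_rdim_add[OF assms(1,2)] dim_eq_rdim_add[OF assms(1,3)] by linarith+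
  ultimately show ?thesis unfolding rdim_def by simp
qed

end

section \<open>Polynomials\<close>

text \<open>Scaling is multiplication by a constant polynomial, so every ideal is a subspace at
  once.\<close>

definition scal :: "'k::field \<Rightarrow> 'k mpoly \<Rightarrow> 'k mpoly" where
  "scal c p = const c * p"

lemma lookup_scal: "Poly_Mapping.lookup (scal c p) m = c * Poly_Mapping.lookup p m"
proof -
  have "scal c p = Poly_Mapping.map ((*) c) p"
    by (simp add: scal_def const_def mult_map_scale_conv_mult)
  then show ?thesis by (simp add: map.rep_eq when_def)
qed

interpretation K: vector_space scal
  by unfold_locales (auto intro!: poly_mapping_eqI simp: lookup_scal lookup_add algebra_simps)

lemma scal_single: "scal c (Poly_Mapping.single m a) = Poly_Mapping.single m (c * a)"
  by (rule poly_mapping_eqI) (simp add: lookup_scal lookup_single when_def)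

lemma scal_mult_left: "scal c p * q = scal c (p * q)"
  by (simp add: scal_def mult.assoc)

lemma scal_mult_right: "p * scal c q = scal c (p * q)"
  by (simp add: scal_def mult.left_commute)

lemma mpoly_expansion:
  "p = (\<Sum>m\<in>Poly_Mapping.keys p. Poly_Mapping.single m (Poly_Mapping.lookup p m))"
  by (rule poly_mapping_eqI)
     (auto simp: lookup_sum lookup_single when_def in_keys_iff)

lemma mpoly_induct [case_names single add]:
  assumes "\<And>m c. P (Poly_Mapping.single m c)" "\<And>p q. P p \<Longrightarrow> P q \<Longrightarrow> P (p + q)"
  shows "P (p :: 'k::field mpoly)"
proof -
  have "P (\<Sum>m\<in>A. Poly_Mapping.single m (Poly_Mapping.lookup p m))" if "finite A" for A
    using that assms by induction (auto, metis single_zero)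
  then show ?thesis by (metis mpoly_expansion finite_keys)
qed

text \<open>Carriers, spaces of forms and spaces of polynomials of bounded degree all have this
  shape; subspace, finiteness and product facts are proved once for it.\<close>

definition supported :: "(nat \<Rightarrow>\<^sub>0 nat) set \<Rightarrow> 'k::field mpoly set" where
  "supported M = {p. Poly_Mapping.keys p \<subseteq> M}"

lemma supported_iff: "p \<in> supported M \<longleftrightarrow> (\<forall>m. m \<notin> M \<longrightarrow> Poly_Mapping.lookup p m = 0)"
  unfolding supported_def by (auto simp: in_keys_iff)

lemma single_supported: "m \<in> M \<Longrightarrow> Poly_Mapping.single m c \<in> supported M"
  by (auto simp: supported_iff lookup_single when_def)

lemma supported_mono: "M \<subseteq> N \<Longrightarrow> supported M \<subseteq> supported N"
  by (auto simp: supported_def)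

lemma subspace_supported: "K.subspace (supported M)"
  by (auto simp: K.subspace_def supported_iff lookup_scal lookup_add)

lemma supported_span: "(supported M :: 'k::field mpoly set) = K.span ((\<lambda>m. Poly_Mapping.single m 1) ` M)"
proof
  show "K.span ((\<lambda>m. Poly_Mapping.single m 1) ` M) \<subseteq> (supported M :: 'k mpoly set)"
    by (intro K.span_minimal subspace_supported) (auto intro: single_supported)
  show "(supported M :: 'k mpoly set) \<subseteq> K.span ((\<lambda>m. Poly_Mapping.single m 1) ` M)"
  proof
    fix p :: "'k mpoly" assume p: "p \<in> supported M"
    have "(\<Sum>m\<in>Poly_Mapping.keys p. Poly_Mapping.single m (Poly_Mapping.lookup p m))
       \<in> K.span ((\<lambda>m. Poly_Mapping.single m 1) ` M)"
    proof (rule K.span_sum)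
      fix m assume "m \<in> Poly_Mapping.keys p"
      then have "m \<in> M" using p by (auto simp: supported_def)
      then have "scal (Poly_Mapping.lookup p m) (Poly_Mapping.single m 1)
          \<in> K.span ((\<lambda>m. Poly_Mapping.single m 1) ` M)"
        by (intro K.span_scale K.span_base) auto
      then show "Poly_Mapping.single m (Poly_Mapping.lookup p m)
          \<in> K.span ((\<lambda>m. Poly_Mapping.single m 1) ` M)" by (simp add: scal_single)
    qed
    then show "p \<in> K.span ((\<lambda>m. Poly_Mapping.single m 1) ` M)" using mpoly_expansion[of p] by simp
  qed
qed

lemma findim_supported: "finite M \<Longrightarrow> K.findim (supported M)"
  unfolding K.findim_def using supported_span subspace_supported by blast

lemma supported_Un:
  assumes "p \<in> supported (M \<union> N)"
  obtains a b where "a \<in> supported M" "b \<in> supported N" "p = a + b"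
proof -
  have "p \<in> K.span ((\<lambda>m. Poly_Mapping.single m 1) ` M \<union> (\<lambda>m. Poly_Mapping.single m 1) ` N)"
    using assms by (simp add: supported_span image_Un)
  then obtain a b where "a \<in> supported M" "b \<in> supported N" "p = a + b"
    by (auto simp: K.span_Un supported_span)
  then show ?thesis using that by blast
qed

section \<open>Linear maps prescribed on monomials\<close>

definition lin_ext :: "((nat \<Rightarrow>\<^sub>0 nat) \<Rightarrow> 'k::field mpoly) \<Rightarrow> 'k mpoly \<Rightarrow> 'k mpoly" where
  "lin_ext f p = (\<Sum>m\<in>Poly_Mapping.keys p. scal (Poly_Mapping.lookup p m) (f m))"

lemma lin_ext_superset:
  assumes "finite A" "Poly_Mapping.keys p \<subseteq> A"
  shows "lin_ext f p = (\<Sum>m\<in>A. scal (Poly_Mapping.lookup p m) (f m))"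
  unfolding lin_ext_def using assms by (intro sum.mono_neutral_left) (auto simp: in_keys_iff)

lemma linear_iff_mpoly:
  "Vector_Spaces.linear scal scal f \<longleftrightarrow> (\<forall>x y. f (x + y) = f x + f y) \<and> (\<forall>c x. f (scal c x) = scal c (f x))"
  using K.vector_space_axioms Vector_Spaces.linear_iff[of scal scal f] by auto

lemma linear_lin_ext: "Vector_Spaces.linear scal scal (lin_ext f :: 'k::field mpoly \<Rightarrow> _)"
  unfolding linear_iff_mpoly
proof (intro conjI allI)
  fix x y :: "'k mpoly" and c
  let ?A = "Poly_Mapping.keys x \<union> Poly_Mapping.keys y"
  have "lin_ext f (x + y) = (\<Sum>m\<in>?A. scal (Poly_Mapping.lookup (x + y) m) (f m))"
    by (intro lin_ext_superset keys_add) simp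
  also have "\<dots> = lin_ext f x + lin_ext f y"
    by (simp add: lin_ext_superset[of ?A] lookup_add K.scale_left_distrib sum.distrib)
  finally show "lin_ext f (x + y) = lin_ext f x + lin_ext f y" .
  have "lin_ext f (scal c x) = (\<Sum>m\<in>Poly_Mapping.keys x. scal (Poly_Mapping.lookup (scal c x) m) (f m))"
    by (intro lin_ext_superset) (auto simp: in_keys_iff lookup_scal)
  then show "lin_ext f (scal c x) = scal c (lin_ext f x)"
    by (simp add: lin_ext_def lookup_scal K.scale_sum_right)
qed

lemma lin_ext_single: "lin_ext f (Poly_Mapping.single m c) = scal c (f m)"
  by (subst lin_ext_superset[of "{m}"]) auto

lemma linear_eq_supported:
  assumes "Vector_Spaces.linear scal scal f" "Vector_Spaces.linear scal scal g"
    "\<And>m. m \<in> M \<Longrightarrow> f (Poly_Mapping.single m 1) = g (Poly_Mapping.single m 1)" "p \<in> supported M"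
  shows "f p = g p"
proof -
  interpret vector_space_pair scal scal by unfold_locales
  show ?thesis
    by (rule linear_eq_on[OF assms(1,2), of _ "(\<lambda>m. Poly_Mapping.single m 1) ` M"])
      (use assms supported_span in auto)
qed

lemma linear_image_supported:
  assumes "Vector_Spaces.linear scal scal f"
    "\<And>m. m \<in> M \<Longrightarrow> f (Poly_Mapping.single m 1) \<in> S" "K.subspace S" "p \<in> supported M"
  shows "f p \<in> S"
proof -
  interpret vector_space_pair scal scal by unfold_locales
  have "f ` supported M = K.span (f ` (\<lambda>m. Poly_Mapping.single m 1) ` M)"
    using linear_span_image[OF assms(1)] supported_span by metis
  moreover have "\<dots> \<subseteq> S" using assms by (intro K.span_minimal) auto
  ultimately show ?thesis using assms by blast
qed

section \<open>Monomials and their degree\<close>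

lemma mdeg_superset:
  "finite A \<Longrightarrow> Poly_Mapping.keys m \<subseteq> A \<Longrightarrow> mdeg m = (\<Sum>i\<in>A. Poly_Mapping.lookup m i)"
  unfolding mdeg_def by (intro sum.mono_neutral_left) (auto simp: in_keys_iff)

lemma mdeg_add: "mdeg (m + m') = mdeg m + mdeg m'"
proof -
  let ?A = "Poly_Mapping.keys m \<union> Poly_Mapping.keys m'"
  have "mdeg (m + m') = (\<Sum>i\<in>?A. Poly_Mapping.lookup (m + m') i)"
    by (intro mdeg_superset keys_add) simp
  then show ?thesis by (simp add: mdeg_superset[of ?A] lookup_add sum.distrib)
qed

lemma mdeg_0 [simp]: "mdeg 0 = 0"
  by (simp add: mdeg_def)

lemma mdeg_single [simp]: "mdeg (Poly_Mapping.single i k) = k"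
  by (subst mdeg_superset[of "{i}"]) auto

definition monoms :: "nat set \<Rightarrow> (nat \<Rightarrow>\<^sub>0 nat) set" where
  "monoms V = {m. Poly_Mapping.keys m \<subseteq> V}"

lemma monoms_add: "m \<in> monoms V \<Longrightarrow> m' \<in> monoms V \<Longrightarrow> m + m' \<in> monoms V"
  unfolding monoms_def using keys_add[of m m'] by blast

lemma zero_monoms [simp]: "0 \<in> monoms V"
  by (simp add: monoms_def)

lemma single_monoms [simp]: "i \<in> V \<Longrightarrow> Poly_Mapping.single i k \<in> monoms V"
  by (auto simp: monoms_def)

text \<open>Each exponent is bounded by the degree, so the exponent vectors lie among the functions
  from \<open>V\<close> to \<open>{..t}\<close>, extended by 0.\<close>

lemma finite_monoms_le:
  assumes "finite V" shows "finite {m \<in> monoms V. mdeg m \<le> t}"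
proof -
  let ?F = "{f. \<forall>x. (x \<in> V \<longrightarrow> f x \<in> {..t}) \<and> (x \<notin> V \<longrightarrow> f x = 0)}"
  have "Poly_Mapping.lookup ` {m \<in> monoms V. mdeg m \<le> t} \<subseteq> ?F"
  proof clarify
    fix m x assume m: "m \<in> monoms V" "mdeg m \<le> t"
    have "Poly_Mapping.lookup m x \<le> mdeg m" if "x \<in> V"
      using assms m that by (subst mdeg_superset[of V]) (auto simp: monoms_def intro: member_le_sum)
    moreover have "Poly_Mapping.lookup m x = 0" if "x \<notin> V"
      using that m by (auto simp: monoms_def in_keys_iff)
    ultimately show "(x \<in> V \<longrightarrow> Poly_Mapping.lookup m x \<in> {..t}) \<and> (x \<notin> V \<longrightarrow> Poly_Mapping.lookup m x = 0)"
      using m by auto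
  qed
  moreover have "finite ?F" using finite_set_of_finite_funs[of V "{..t}"] assms by simp
  ultimately have "finite (Poly_Mapping.lookup ` {m \<in> monoms V. mdeg m \<le> t})"
    by (rule finite_subset)
  then show ?thesis by (rule finite_imageD) (simp add: inj_on_def poly_mapping_eqI)
qed

section \<open>Forms, polynomials of bounded degree, homogeneous components\<close>

lemma carrier_polys: "carrier (polys V) = supported (monoms V)"
  by (auto simp: polys_def supported_def monoms_def)

lemma polys_simps [simp]:
  "x \<otimes>\<^bsub>polys V\<^esub> y = x * y" "\<one>\<^bsub>polys V\<^esub> = 1" "\<zero>\<^bsub>polys V\<^esub> = 0" "x \<oplus>\<^bsub>polys V\<^esub> y = x + y"
  by (simp_all add: polys_def)

lemma forms_supported: "forms V t = supported {m \<in> monoms V. mdeg m = t}"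
  unfolding forms_def carrier_polys by (auto simp: supported_def)

text \<open>This is what the forms of degree \<open>t\<close> in one more variable become when that
  variable is set to 1.\<close>

definition lowdeg :: "nat set \<Rightarrow> nat \<Rightarrow> 'k::field mpoly set" where
  "lowdeg V t = supported {m \<in> monoms V. mdeg m \<le> t}"

lemma findim_lowdeg: "finite V \<Longrightarrow> K.findim (lowdeg V t)"
  unfolding lowdeg_def by (intro findim_supported finite_monoms_le)

lemma findim_forms: "finite V \<Longrightarrow> K.findim (forms V t)"
  unfolding forms_supported
  by (intro findim_supported finite_subset[OF _ finite_monoms_le[of V t]]) auto

lemma lowdeg_carrier: "lowdeg V t \<subseteq> carrier (polys V)"
  unfolding lowdeg_def carrier_polys by (intro supported_mono) auto

lemma forms_carrier: "forms V t \<subseteq> carrier (polys V)"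
  unfolding forms_def by auto

lemma lowdeg_mono: "t \<le> t' \<Longrightarrow> lowdeg V t \<subseteq> lowdeg V t'"
  unfolding lowdeg_def by (intro supported_mono) auto

lemma forms_lowdeg: "t \<le> t' \<Longrightarrow> forms V t \<subseteq> lowdeg V t'"
  unfolding lowdeg_def forms_supported by (intro supported_mono) auto

lemma lookup_hcomp:
  "Poly_Mapping.lookup (hcomp t p) m = (if mdeg m = t then Poly_Mapping.lookup p m else 0)"
  unfolding hcomp_def
  by (auto simp: lookup_sum lookup_single when_def in_keys_iff)

lemma hcomp_add: "hcomp t (p + q) = hcomp t p + hcomp t q"
  by (rule poly_mapping_eqI) (simp add: lookup_hcomp lookup_add)

lemma hcomp_0 [simp]: "hcomp t 0 = 0"
  by (rule poly_mapping_eqI) (simp add: lookup_hcomp)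

lemma hcomp_single: "hcomp t (Poly_Mapping.single m c) = (if mdeg m = t then Poly_Mapping.single m c else 0)"
  by (rule poly_mapping_eqI) (auto simp: lookup_hcomp lookup_single when_def)

lemma hcomp_forms: "p \<in> carrier (polys V) \<Longrightarrow> hcomp t p \<in> forms V t"
  unfolding carrier_polys forms_supported by (auto simp: supported_iff lookup_hcomp)

lemma hcomp_of_form: "p \<in> forms V t \<Longrightarrow> hcomp t' p = (if t' = t then p else 0)"
  unfolding forms_supported
  by (intro poly_mapping_eqI) (auto simp: lookup_hcomp supported_iff)

lemma hcomp_decomposition:
  assumes "\<And>m. m \<in> Poly_Mapping.keys p \<Longrightarrow> mdeg m \<le> N"
  shows "p = (\<Sum>t\<le>N. hcomp t p)"
proof (rule poly_mapping_eqI)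
  fix m
  show "Poly_Mapping.lookup p m = Poly_Mapping.lookup (\<Sum>t\<le>N. hcomp t p) m"
    using assms[of m] by (auto simp: lookup_sum lookup_hcomp in_keys_iff)
qed

lemma carrier_lowdeg:
  assumes "p \<in> carrier (polys V)" obtains N where "p \<in> lowdeg V N"
proof
  \<comment> \<open>The sum of all monomial degrees is a crude bound for each of them, and it is
    also defined for \<open>p = 0\<close>.\<close>
  show "p \<in> lowdeg V (\<Sum>m\<in>Poly_Mapping.keys p. mdeg m)"
    using assms unfolding lowdeg_def carrier_polys supported_def
    by (auto intro: member_le_sum)
qed

lemma lowdeg_decomposition: "p \<in> lowdeg V N \<Longrightarrow> p = (\<Sum>t\<le>N. hcomp t p)"
  by (rule hcomp_decomposition) (auto simp: lowdeg_def supported_def)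

lemma hcomp_mult: "hcomp t (p * q) = (\<Sum>i\<le>t. hcomp i p * hcomp (t - i) q)"
proof (induction p rule: mpoly_induct)
  case (single m c)
  show ?case
  proof (induction q rule: mpoly_induct)
    case (single m' c')
    \<comment> \<open>Only the summand \<open>i = mdeg m\<close> survives, and it is in range
      exactly if \<open>mdeg m\<close> is at most \<open>t\<close>.\<close>
    have "(\<Sum>i\<le>t. hcomp i (Poly_Mapping.single m c) * hcomp (t - i) (Poly_Mapping.single m' c'))
       = (\<Sum>i\<le>t. if mdeg m = i then Poly_Mapping.single m c * hcomp (t - i) (Poly_Mapping.single m' c') else 0)"
      by (intro sum.cong) (auto simp: hcomp_single)
    also have "\<dots> = (if mdeg m \<le> t then Poly_Mapping.single m c * hcomp (t - mdeg m) (Poly_Mapping.single m' c') else 0)"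
      by simp
    finally show ?case by (auto simp: mult_single hcomp_single mdeg_add)
  qed (simp add: hcomp_add algebra_simps sum.distrib)
qed (simp add: hcomp_add algebra_simps sum.distrib)

lemma supported_mult:
  assumes "p \<in> supported M" "q \<in> supported N" "\<And>m n. m \<in> M \<Longrightarrow> n \<in> N \<Longrightarrow> m + n \<in> L"
  shows "p * q \<in> supported L"
  using assms keys_mult[of p q] unfolding supported_def by blast

lemma polys_mult_closed: "p \<in> carrier (polys V) \<Longrightarrow> q \<in> carrier (polys V) \<Longrightarrow> p * q \<in> carrier (polys V)"
  unfolding carrier_polys by (erule supported_mult) (auto intro: monoms_add)

lemma forms_mult: "p \<in> forms V s \<Longrightarrow> q \<in> forms V t \<Longrightarrow> p * q \<in> forms V (s + t)"
  unfolding forms_supported by (erule supported_mult) (auto intro: monoms_add simp: mdeg_add)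

lemma forms_subspace: "K.subspace (forms V t)"
  unfolding forms_supported by (rule subspace_supported)

lemma carrier_subspace: "K.subspace (carrier (polys V))"
  unfolding carrier_polys by (rule subspace_supported)

lemma var_forms: "i \<in> V \<Longrightarrow> var i \<in> forms V 1"
  unfolding var_def forms_supported by (intro single_supported) auto

lemma var_carrier: "i \<in> V \<Longrightarrow> var i \<in> carrier (polys V)"
  using var_forms forms_carrier by blast

lemma const_carrier [simp]: "const c \<in> carrier (polys V)"
  unfolding const_def carrier_polys by (intro single_supported) auto

lemma const_1 [simp]: "const 1 = 1"
  by (simp add: const_def)

lemma const_0 [simp]: "const 0 = 0"
  by (simp add: const_def)

section \<open>The polynomial ring as an algebraic structure, and its ideals\<close>

lemma cring_polys: "cring (polys V :: 'k::field mpoly ring)"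
proof -
  have c: "x + y \<in> carrier (polys V)" if "x \<in> carrier (polys V)" "y \<in> carrier (polys V)" for x y :: "'k mpoly"
    using that carrier_subspace K.subspace_add by blast
  have n: "- x \<in> carrier (polys V)" if "x \<in> carrier (polys V)" for x :: "'k mpoly"
    using that carrier_subspace K.subspace_neg by blast
  have z: "0 \<in> carrier (polys V)" "1 \<in> carrier (polys V)"
    using const_carrier[of 0] const_carrier[of 1] by auto
  show ?thesis
  proof (rule cringI)
    show "abelian_group (polys V :: 'k mpoly ring)"
      using c n z by (intro abelian_groupI) (auto simp: algebra_simps intro!: bexI[of _ "- _"])
    show "Group.comm_monoid (polys V :: 'k mpoly ring)"
      using z polys_mult_closed by (intro comm_monoidI) (auto simp: algebra_simps)
  qed (auto simp: algebra_simps)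
qed

lemma ring_polys: "ring (polys V)"
  using cring_polys cring.axioms by blast

lemma a_inv_polys: "x \<in> carrier (polys V) \<Longrightarrow> \<ominus>\<^bsub>polys V\<^esub> x = - x"
  by (metis abelian_group.minus_equality carrier_subspace K.subspace_neg cring_polys
    cring.cring_simprules(4) left_minus polys_simps(3,4) ring.axioms(1) ring_polys)

lemma ideal_polysI:
  fixes J :: "'k::field mpoly set"
  assumes "J \<subseteq> carrier (polys V)" "0 \<in> J" "\<And>a b. a \<in> J \<Longrightarrow> b \<in> J \<Longrightarrow> a + b \<in> J"
    "\<And>r a. r \<in> carrier (polys V) \<Longrightarrow> a \<in> J \<Longrightarrow> r * a \<in> J"
  shows "ideal J (polys V)"
proof (rule idealI)
  show "ring (polys V :: 'k mpoly ring)" by (rule ring_polys)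
  \<comment> \<open>Negation is multiplication by the constant -1, so closure under products already
    covers it.\<close>
  have "- a \<in> J" if "a \<in> J" for a
    using assms(4)[OF const_carrier that, of "-1"] by (simp add: const_def single_uminus)
  then have "inv\<^bsub>add_monoid (polys V)\<^esub> a \<in> J" if "a \<in> J" for a
    using that assms(1) a_inv_polys[of a V] by (auto simp: a_inv_def subset_iff)
  then show "subgroup J (add_monoid (polys V))"
    using assms by (intro subgroup.intro) auto
  fix a x :: "'k mpoly" assume "a \<in> J" "x \<in> carrier (polys V)"
  then have "x * a \<in> J" using assms(4) by blast
  then show "x \<otimes>\<^bsub>polys V\<^esub> a \<in> J" "a \<otimes>\<^bsub>polys V\<^esub> x \<in> J"
    by (simp_all add: mult.commute)
qed

lemma ideal_polysD:
  assumes "ideal J (polys V)"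
  shows "J \<subseteq> carrier (polys V)" "0 \<in> J" "a \<in> J \<Longrightarrow> b \<in> J \<Longrightarrow> a + b \<in> J"
    "r \<in> carrier (polys V) \<Longrightarrow> a \<in> J \<Longrightarrow> r * a \<in> J"
proof -
  interpret ideal J "polys V" by (rule assms)
  show "J \<subseteq> carrier (polys V)" using Icarr by blast
  show "0 \<in> J" using additive_subgroup.zero_closed[OF is_additive_subgroup] by simp
  show "a \<in> J \<Longrightarrow> b \<in> J \<Longrightarrow> a + b \<in> J"
    using additive_subgroup.a_closed[OF is_additive_subgroup] by simp
  show "r \<in> carrier (polys V) \<Longrightarrow> a \<in> J \<Longrightarrow> r * a \<in> J" using I_l_closed by fastforce
qed

lemma ideal_subspace: "ideal J (polys V) \<Longrightarrow> K.subspace J"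
  unfolding K.subspace_def scal_def using ideal_polysD const_carrier by blast

section \<open>Dimensions in graded quotients\<close>

lemma residue_conv: "residue V J p = (\<lambda>j. j + p) ` J"
  by (auto simp: a_r_coset_def')

lemma carrier_Quot: "carrier (polys V Quot J) = residue V J ` carrier (polys V)"
  by (auto simp: FactRing_def A_RCOSETS_def')

lemma linear_mult: "Vector_Spaces.linear scal scal ((*) (p :: 'k::field mpoly))"
  unfolding linear_iff_mpoly by (simp add: algebra_simps scal_mult_right)

context
  fixes V :: "nat set" and J :: "'k::field mpoly set"
  assumes J: "ideal J (polys V)"
begin

interpretation ideal J "polys V" by (rule J)

private lemmas J_subspace = ideal_subspace[OF J]

lemma residue_eq_iff: "residue V J p = residue V J q \<longleftrightarrow> p - q \<in> J"
proof
  assume "residue V J p = residue V J q"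
  moreover have "p \<in> residue V J p"
    unfolding residue_conv using K.subspace_0[OF J_subspace] by force
  ultimately show "p - q \<in> J" unfolding residue_conv by auto
next
  assume pq: "p - q \<in> J"
  show "residue V J p = residue V J q"
    unfolding residue_conv
  proof (intro equalityI image_subsetI)
    fix j assume "j \<in> J"
    then have "j + (p - q) \<in> J" "j - (p - q) \<in> J"
      using pq J_subspace K.subspace_add K.subspace_diff by blast+
    then show "j + p \<in> (\<lambda>j. j + q) ` J" "j + q \<in> (\<lambda>j. j + p) ` J"
      by (auto simp: image_iff intro: bexI[of _ "j + (p - q)"] bexI[of _ "j - (p - q)"])
  qed
qed

lemma Quot_zero: "\<zero>\<^bsub>polys V Quot J\<^esub> = J"
  by (simp add: FactRing_def)

lemma residue_eq_J: "residue V J p = J \<longleftrightarrow> p \<in> J"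
proof -
  have "residue V J 0 = J" unfolding residue_conv by auto
  then show ?thesis using residue_eq_iff[of p 0] by simp
qed

lemma residue_add:
  "p \<in> carrier (polys V) \<Longrightarrow> q \<in> carrier (polys V) \<Longrightarrow>
    residue V J p \<oplus>\<^bsub>polys V Quot J\<^esub> residue V J q = residue V J (p + q)"
  using ring_hom_add[OF rcos_ring_hom] by simp

lemma residue_mult:
  "p \<in> carrier (polys V) \<Longrightarrow> q \<in> carrier (polys V) \<Longrightarrow>
    residue V J p \<otimes>\<^bsub>polys V Quot J\<^esub> residue V J q = residue V J (p * q)"
  using ring_hom_mult[OF rcos_ring_hom] by simp

text \<open>Uniqueness of \<open>ring.dim\<close> is a statement over a subfield; this one is
  carried over to the quotient in \<open>kdim_residue\<close>.\<close>

lemma subfield_consts: "subfield (range const) (polys V :: 'k mpoly ring)"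
proof -
  have m: "const a * const b = const (a * b)" for a b :: 'k
    by (simp add: const_def mult_single)
  have "subring (range const) (polys V :: 'k mpoly ring)"
  proof (rule subringI)
    fix x y :: "'k mpoly" assume "x \<in> range const" "y \<in> range const"
    then show "x \<otimes>\<^bsub>polys V\<^esub> y \<in> range const" "x \<oplus>\<^bsub>polys V\<^esub> y \<in> range const"
      by (auto simp: m) (auto simp: const_def single_add[symmetric])
  next
    fix x :: "'k mpoly" assume "x \<in> range const"
    then obtain c where "x = const c" by auto
    then show "\<ominus>\<^bsub>polys V\<^esub> x \<in> range const"
      using a_inv_polys[OF const_carrier, of V c] by (auto simp: const_def single_uminus[symmetric])
  next
    show "\<one>\<^bsub>polys V\<^esub> \<in> range (const :: 'k \<Rightarrow> _)" using const_1 by (metis polys_simps(2) rangeI)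
  qed auto
  then have sub: "subcring (range const) (polys V :: 'k mpoly ring)"
    using cring.subcringI'[OF cring_polys] by blast
  show ?thesis
  proof (rule subfieldI[OF sub])
    show "Units (polys V\<lparr>carrier := range const\<rparr>) = range (const :: 'k \<Rightarrow> _) - {\<zero>\<^bsub>polys V\<^esub>}"
    proof (intro equalityI subsetI)
      fix x :: "'k mpoly" assume "x \<in> Units (polys V\<lparr>carrier := range const\<rparr>)"
      then obtain y where "x \<in> range const" "y * x = 1" by (auto simp: Units_def)
      then show "x \<in> range const - {\<zero>\<^bsub>polys V\<^esub>}" by auto
    next
      fix x :: "'k mpoly" assume "x \<in> range const - {\<zero>\<^bsub>polys V\<^esub>}"
      then obtain c where c: "x = const c" "c \<noteq> 0" by (cases "x = 0") (auto, metis const_0)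
      then have "const (inverse c) * x = 1" "x * const (inverse c) = 1" by (simp_all add: m)
      then show "x \<in> Units (polys V\<lparr>carrier := range const\<rparr>)"
        unfolding Units_def using c by auto
    qed
  qed
qed

text \<open>\<open>ring.dimension\<close> is inductive, with one line extension per step, so the
  basis is adjoined vector by vector. Independence of \<open>C\<close> together with
  \<open>span C\<close> meeting \<open>J\<close> only in 0 shows that each new residue lies outside
  the span reached so far.\<close>

lemma dimension_span:
  assumes "finite C" "K.independent C" "K.span C \<inter> J \<subseteq> {0}" "C \<subseteq> carrier (polys V)"
  shows "ring.dimension (polys V Quot J) (card C) (residue V J ` range const) (residue V J ` K.span C)"
  using assms
proof (induction C)
  case empty
  have "residue V J ` K.span {} = {\<zero>\<^bsub>polys V Quot J\<^esub>}"
    using residue_eq_J[of 0] K.subspace_0[OF J_subspace] by (simp add: Quot_zero)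
  then show ?case using ring.zero_dim[OF quotient_is_ring] by simp
next
  case (insert c C)
  let ?Q = "polys V Quot J" and ?K = "residue V J ` range const"
  have ind: "K.independent C" "c \<notin> K.span C"
    using insert.prems insert.hyps by (auto simp: K.independent_insert)
  have sub: "K.span C \<subseteq> K.span (insert c C)" by (rule K.span_mono) auto
  have spC: "K.span (insert c C) \<subseteq> carrier (polys V)"
    using insert.prems by (intro K.span_minimal carrier_subspace)
  have c: "c \<in> carrier (polys V)" using insert.prems by simp
  have "residue V J c \<notin> residue V J ` K.span C"
  proof
    assume "residue V J c \<in> residue V J ` K.span C"
    then obtain d where d: "d \<in> K.span C" "c - d \<in> J" using residue_eq_iff by blast
    then have "c - d \<in> K.span (insert c C)"
      using sub K.span_base[of c "insert c C"] by (intro K.span_diff) auto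
    then have "c - d = 0" using d insert.prems by blast
    then show False using d ind by simp
  qed
  moreover have "ring.line_extension ?Q ?K (residue V J c) (residue V J ` K.span C)
      = residue V J ` K.span (insert c C)"
  proof -
    have "ring.line_extension ?Q ?K (residue V J c) (residue V J ` K.span C)
      = {residue V J (const a) \<otimes>\<^bsub>?Q\<^esub> residue V J c \<oplus>\<^bsub>?Q\<^esub> residue V J e |a e. e \<in> K.span C}"
      unfolding ring.line_extension_def[OF quotient_is_ring] set_add_def' r_coset_def by auto
    also have "\<dots> = {residue V J (scal a c + e) |a e. e \<in> K.span C}"
    proof -
      have "residue V J (const a) \<otimes>\<^bsub>?Q\<^esub> residue V J c \<oplus>\<^bsub>?Q\<^esub> residue V J e = residue V J (scal a c + e)"
        if "e \<in> K.span C" for a e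
      proof -
        have "e \<in> carrier (polys V)" "const a * c \<in> carrier (polys V)"
          using that sub spC polys_mult_closed[OF const_carrier c] by auto
        then show ?thesis using c by (simp add: residue_mult residue_add scal_def)
      qed
      then show ?thesis by (metis (no_types, lifting))
    qed
    also have "\<dots> = residue V J ` K.span (insert c C)"
    proof (intro equalityI subsetI)
      fix x assume "x \<in> {residue V J (scal a c + e) |a e. e \<in> K.span C}"
      then obtain a e where x: "x = residue V J (scal a c + e)" "e \<in> K.span C" by blast
      have "scal a c + e \<in> K.span (insert c C)"
        using x sub K.span_base[of c "insert c C"] by (intro K.span_add K.span_scale) auto
      then show "x \<in> residue V J ` K.span (insert c C)" using x by blast
    next
      fix x assume "x \<in> residue V J ` K.span (insert c C)"
      then obtain y where y: "y \<in> K.span (insert c C)" "x = residue V J y" by blast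
      then obtain a where "y - scal a c \<in> K.span C" using K.span_breakdown_eq by blast
      then show "x \<in> {residue V J (scal a c + e) |a e. e \<in> K.span C}"
        using y by (auto intro!: exI[of _ a] exI[of _ "y - scal a c"])
    qed
    finally show ?thesis .
  qed
  moreover have "ring.dimension ?Q (card C) ?K (residue V J ` K.span C)"
    using insert ind sub by auto
  moreover have "residue V J c \<in> carrier ?Q" using c carrier_Quot by blast
  ultimately show ?case
    using ring.Suc_dim[OF quotient_is_ring, of "residue V J c" "residue V J ` K.span C" "card C" ?K] insert.hyps
    by simp
qed

text \<open>The bridge from the factor ring to polynomials. As \<open>ring.dim\<close> is a definite
  description, existence of a dimension is not enough and uniqueness must be shown too.\<close>

lemma kdim_residue:
  assumes "K.findim U" "U \<subseteq> carrier (polys V)"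
  shows "kdim V J (residue V J ` U) = K.rdim J U"
proof -
  let ?Q = "polys V Quot J" and ?K = "residue V J ` range const"
  obtain C where C: "K.rbasis J U C" using K.rbasis_exists[OF assms(1) J_subspace] .
  have CU: "K.span C \<subseteq> U"
    using C K.findim_subspace[OF assms(1)] unfolding K.rbasis_def by (intro K.span_minimal) auto
  have "residue V J ` U = residue V J ` K.span C"
  proof
    show "residue V J ` U \<subseteq> residue V J ` K.span C"
      using C residue_eq_iff unfolding K.rbasis_def by blast
  qed (use CU in auto)
  then have d: "ring.dimension ?Q (K.rdim J U) ?K (residue V J ` U)"
    using dimension_span[of C] C assms CU K.rbasis_rdim[OF assms(1) J_subspace C]
    unfolding K.rbasis_def by auto
  have uniq: "n = K.rdim J U" if n: "ring.dimension ?Q n ?K (residue V J ` U)" for n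
  \<comment> \<open>If \<open>J\<close> contains 1, the quotient is the zero ring and the image of K
    is no field; there only the rule for dimension 0 can fire, since no vector lies outside a
    subspace. Otherwise K embeds as a subfield and the general uniqueness theorem applies.\<close>
  proof (cases "1 \<in> J")
    case True
    have "p \<in> J" if "p \<in> carrier (polys V)" for p
      using ideal_polysD(4)[OF J that True] by simp
    then have triv: "carrier ?Q \<subseteq> {\<zero>\<^bsub>?Q\<^esub>}"
      using residue_eq_J by (auto simp: Quot_zero carrier_Quot)
    have "n = 0 \<and> E = {\<zero>\<^bsub>?Q\<^esub>}" if "ring.dimension ?Q n ?K E" for n E
      using that
    proof (induction rule: ring.dimension.induct[OF quotient_is_ring, consumes 1])
      case (2 v E n K)
      then show ?case using triv by blast
    qed simp
    then show ?thesis using n d by metis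
  next
    case False
    interpret h: ring_hom_ring "polys V" ?Q "(+>\<^bsub>polys V\<^esub>) J" by (rule rcos_ring_hom_ring)
    have "\<one>\<^bsub>?Q\<^esub> \<noteq> \<zero>\<^bsub>?Q\<^esub>"
      using False residue_eq_J[of 1] ring_hom_one[OF rcos_ring_hom] by (simp add: Quot_zero)
    then have "subfield ?K ?Q" using h.img_is_subfield(2)[OF subfield_consts] by simp
    then show ?thesis using ring.dimension_is_inj[OF quotient_is_ring] n d by blast
  qed
  have "ring.dim ?Q ?K (residue V J ` U) = K.rdim J U"
    unfolding ring.dim_def[OF quotient_is_ring] using d uniq by (rule the_equality)
  then show ?thesis unfolding kdim_def over_def .
qed

lemma hilbert_function_rdim: "finite V \<Longrightarrow> hilbert_function V J t = K.rdim J (forms V t)"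
  unfolding hilbert_function_def degree_piece_def
  by (intro kdim_residue findim_forms forms_carrier)

text \<open>The image of multiplication by the residue of \<open>g\<close> consists of the residues
  of \<open>g * f\<close>, so its rank is the dimension of these products modulo
  \<open>J\<close>.\<close>

lemma weak_lefschetz_rdim:
  assumes "finite V"
  shows "weak_lefschetz V J \<longleftrightarrow> (\<exists>g\<in>forms V 1. \<forall>i.
     K.rdim J ((*) g ` forms V i) = min (hilbert_function V J i) (hilbert_function V J (i + 1)))"
proof -
  have "kdim V J ((\<lambda>a. residue V J g \<otimes>\<^bsub>polys V Quot J\<^esub> a) ` degree_piece V J i)
      = K.rdim J ((*) g ` forms V i)" if "g \<in> forms V 1" for g i
  proof -
    have g: "g \<in> carrier (polys V)" using that forms_carrier by blast
    have "(\<lambda>a. residue V J g \<otimes>\<^bsub>polys V Quot J\<^esub> a) ` degree_piece V J i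
        = (\<lambda>f. residue V J (g * f)) ` forms V i"
      unfolding degree_piece_def image_image using g forms_carrier
      by (intro image_cong) (auto intro!: residue_mult)
    also have "\<dots> = residue V J ` (*) g ` forms V i" by (simp add: image_image)
    finally show ?thesis
      using K.findim_image[OF linear_mult findim_forms[OF assms]]
        polys_mult_closed[OF g subsetD[OF forms_carrier]]
      by (subst kdim_residue[symmetric]) auto
  qed
  then show ?thesis unfolding weak_lefschetz_def degree_piece_def[of V J 1] by auto
qed

text \<open>Annihilation by the maximal ideal need only be tested on its generators, the
  variables.\<close>

lemma socle_dim_rdim:
  assumes "finite V"
  shows "socle_dim V J i = K.rdim J {f \<in> forms V i. \<forall>x\<in>V. var x * f \<in> J}"
proof -
  let ?S = "{f \<in> forms V i. \<forall>x\<in>V. var x * f \<in> J}"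
  have irr: "(irrelevant_ideal V :: 'k mpoly set) \<subseteq> carrier (polys V)" "(var :: nat \<Rightarrow> 'k mpoly) ` V \<subseteq> irrelevant_ideal V"
    unfolding irrelevant_ideal_def
    using ideal_polysD(1)[OF ring.genideal_ideal[OF ring_polys, of "var ` V" V]]
      ring.genideal_self[OF ring_polys, of "var ` V" V] var_carrier by blast+
  have key: "(\<forall>p\<in>irrelevant_ideal V. p * f \<in> J) \<longleftrightarrow> (\<forall>x\<in>V. var x * f \<in> J)"
    if f: "f \<in> carrier (polys V)" for f
  proof
    assume *: "\<forall>x\<in>V. var x * f \<in> J"
    \<comment> \<open>The colon ideal of \<open>J\<close> by \<open>f\<close>: once it contains the
      variables, it contains the ideal they generate.\<close>
    let ?A = "{p \<in> carrier (polys V). p * f \<in> J}"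
    have "ideal ?A (polys V)"
    proof (rule ideal_polysI)
      show "0 \<in> ?A" using K.subspace_0[OF carrier_subspace] ideal_polysD(2)[OF J] by simp
      show "a + b \<in> ?A" if "a \<in> ?A" "b \<in> ?A" for a b
        using that ideal_polysD(3)[OF J] by (simp add: distrib_right K.subspace_add[OF carrier_subspace])
      show "r * a \<in> ?A" if "r \<in> carrier (polys V)" "a \<in> ?A" for r a
        using that ideal_polysD(4)[OF J] by (simp add: mult.assoc polys_mult_closed)
    qed blast
    moreover have "var ` V \<subseteq> ?A" using * var_carrier by auto
    ultimately have "irrelevant_ideal V \<subseteq> ?A"
      unfolding irrelevant_ideal_def by (rule ring.genideal_minimal[OF ring_polys])
    then show "\<forall>p\<in>irrelevant_ideal V. p * f \<in> J" by blast
  qed (use irr in blast)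
  have "residue V J f \<in> socle V J \<longleftrightarrow> (\<forall>x\<in>V. var x * f \<in> J)" if f: "f \<in> forms V i" for f
  proof -
    have fc: "f \<in> carrier (polys V)" using f forms_carrier by blast
    have "residue V J p \<otimes>\<^bsub>polys V Quot J\<^esub> residue V J f = \<zero>\<^bsub>polys V Quot J\<^esub> \<longleftrightarrow> p * f \<in> J"
      if "p \<in> irrelevant_ideal V" for p
    proof -
      have "p \<in> carrier (polys V)" using that irr by blast
      then show ?thesis using fc by (simp add: residue_mult Quot_zero residue_eq_J)
    qed
    then show ?thesis using key[OF fc] fc unfolding socle_def carrier_Quot by auto
  qed
  then have "socle V J \<inter> degree_piece V J i = residue V J ` ?S"
    unfolding degree_piece_def by blast
  moreover have "K.subspace ?S"
    using forms_subspace[of V i] J_subspace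
    unfolding K.subspace_def by (auto simp: distrib_left scal_mult_right)
  ultimately show ?thesis unfolding socle_dim_def
    using K.findim_subset[OF findim_forms[OF assms], of ?S i] forms_carrier[of V i]
    by (subst kdim_residue[symmetric]) auto
qed

lemma kdim_carrier:
  assumes "K.findim P" "P \<subseteq> carrier (polys V)" "\<And>p. p \<in> carrier (polys V) \<Longrightarrow> \<exists>q\<in>P. p - q \<in> J"
  shows "kdim V J (carrier (polys V Quot J)) = K.rdim J P"
proof -
  have "carrier (polys V Quot J) = residue V J ` P"
    unfolding carrier_Quot
  proof
    show "residue V J ` carrier (polys V) \<subseteq> residue V J ` P"
    proof clarify
      fix p :: "'k mpoly" assume "p \<in> carrier (polys V)"
      then obtain q where "q \<in> P" "p - q \<in> J" using assms(3) by blast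
      then show "residue V J p \<in> residue V J ` P" using residue_eq_iff[of p q] by blast
    qed
  qed (use assms(2) in blast)
  then show ?thesis using kdim_residue[OF assms(1,2)] by simp
qed

text \<open>A descending chain of ideals of the quotient is pulled back to a descending chain of
  subspaces of the finite-dimensional space \<open>P\<close> of representatives.\<close>

lemma artinian_Quot:
  assumes "K.findim P" "P \<subseteq> carrier (polys V)" "\<And>p. p \<in> carrier (polys V) \<Longrightarrow> \<exists>q\<in>P. p - q \<in> J"
  shows "artinian_ring (polys V Quot J)"
  unfolding artinian_ring_def
proof (intro allI impI, elim conjE)
  let ?Q = "polys V Quot J"
  fix C :: "nat \<Rightarrow> 'k mpoly set set"
  assume id: "\<forall>i. ideal (C i) ?Q" and dec: "\<forall>i. C (Suc i) \<subseteq> C i"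
  define U where "U i = {p \<in> P. residue V J p \<in> C i}" for i
  have CU: "C i = residue V J ` U i" for i
  proof
    show "C i \<subseteq> residue V J ` U i"
    proof
      fix a assume a: "a \<in> C i"
      then have "a \<in> carrier ?Q" using id ideal.Icarr by metis
      then obtain p where p: "p \<in> carrier (polys V)" "a = residue V J p" using carrier_Quot by blast
      then obtain q where q: "q \<in> P" "p - q \<in> J" using assms(3) by blast
      then have "a = residue V J q" using p residue_eq_iff by simp
      then show "a \<in> residue V J ` U i" using a q U_def by blast
    qed
  qed (auto simp: U_def)
  have sP: "K.subspace P" using K.findim_subspace assms(1) .
  have sU: "K.subspace (U i)" for i
  proof -
    interpret Ci: ideal "C i" ?Q using id by simp
    have "residue V J 0 = \<zero>\<^bsub>?Q\<^esub>" using residue_eq_J[of 0] K.subspace_0[OF J_subspace] by (simp add: Quot_zero)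
    then have "0 \<in> U i"
      using K.subspace_0[OF sP] additive_subgroup.zero_closed[OF Ci.is_additive_subgroup] by (simp add: U_def)
    moreover have "x + y \<in> U i" if "x \<in> U i" "y \<in> U i" for x y
      using that K.subspace_add[OF sP] residue_add[of x y] assms(2)
        additive_subgroup.a_closed[OF Ci.is_additive_subgroup, of "residue V J x" "residue V J y"]
      by (auto simp: U_def subset_iff)
    moreover have "scal c x \<in> U i" if "x \<in> U i" for c x
      using that K.subspace_scale[OF sP] residue_mult[of "const c" x] assms(2)
        Ci.I_l_closed[of "residue V J x" "residue V J (const c)"] carrier_Quot[of V J]
      by (auto simp: U_def subset_iff scal_def)
    ultimately show ?thesis unfolding K.subspace_def by blast
  qed
  have fU: "K.findim (U i)" for i
    by (rule K.findim_subset[OF assms(1) sU]) (auto simp: U_def)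
  have anti: "U j \<subseteq> U i" if "i \<le> j" for i j
    using lift_Suc_antimono_le[of C, OF _ that] dec by (auto simp: U_def)
  \<comment> \<open>At an index of least dimension the chain of subspaces can shrink no
    further.\<close>
  obtain N where N: "\<And>i. K.dim (U N) \<le> K.dim (U i)"
    using ex_has_least_nat[of "\<lambda>_. True" 0 "\<lambda>i. K.dim (U i)"] by auto
  have "U i = U N" if "i \<ge> N" for i
    by (rule K.findim_eqI[OF fU anti[OF that] sU N])
  then show "\<exists>N. \<forall>i\<ge>N. C i = C N" using CU by metis
qed

end

section \<open>Dehomogenization\<close>

definition drop_var :: "nat \<Rightarrow> (nat \<Rightarrow>\<^sub>0 nat) \<Rightarrow> (nat \<Rightarrow>\<^sub>0 nat)" where
  "drop_var v m = Poly_Mapping.update v 0 m"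

lemma lookup_drop_var: "Poly_Mapping.lookup (drop_var v m) i = (if i = v then 0 else Poly_Mapping.lookup m i)"
  by (simp add: drop_var_def lookup_update)

lemma drop_var_add: "drop_var v (m + n) = drop_var v m + drop_var v n"
  by (rule poly_mapping_eqI) (simp add: lookup_drop_var lookup_add)

lemma drop_var_decomp: "drop_var v m + Poly_Mapping.single v (Poly_Mapping.lookup m v) = m"
  by (rule poly_mapping_eqI) (simp add: lookup_drop_var lookup_add lookup_single when_def)

lemma mdeg_drop_var: "mdeg (drop_var v m) + Poly_Mapping.lookup m v = mdeg m"
  by (metis drop_var_decomp mdeg_add mdeg_single)

lemma drop_var_monoms: "m \<in> monoms (insert v W) \<Longrightarrow> drop_var v m \<in> monoms W"
  by (auto simp: monoms_def in_keys_iff subset_iff lookup_drop_var split: if_splits)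

lemma drop_var_id: "m \<in> monoms W \<Longrightarrow> v \<notin> W \<Longrightarrow> drop_var v m = m"
  by (rule poly_mapping_eqI) (auto simp: monoms_def in_keys_iff subset_iff lookup_drop_var)

text \<open>The substitution of 1 for the variable \<open>v\<close>, defined monomial by
  monomial.\<close>

definition dehom :: "nat \<Rightarrow> 'k::field mpoly \<Rightarrow> 'k mpoly" where
  "dehom v = lin_ext (\<lambda>m. Poly_Mapping.single (drop_var v m) 1)"

text \<open>Each monomial is filled up with a power of \<open>v\<close> to degree \<open>t\<close>.
  The truncated difference does this only for monomials of degree at most \<open>t\<close>, whence
  the restriction to \<open>lowdeg\<close> below.\<close>

definition homog :: "nat \<Rightarrow> nat \<Rightarrow> 'k::field mpoly \<Rightarrow> 'k mpoly" where
  "homog v t = lin_ext (\<lambda>m. Poly_Mapping.single (m + Poly_Mapping.single v (t - mdeg m)) 1)"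

lemma linear_dehom: "Vector_Spaces.linear scal scal (dehom v)"
  unfolding dehom_def by (rule linear_lin_ext)

lemma linear_homog: "Vector_Spaces.linear scal scal (homog v t)"
  unfolding homog_def by (rule linear_lin_ext)

lemma dehom_add: "dehom v (p + q) = dehom v p + dehom v q"
  by (simp add: linear_dehom[unfolded linear_iff_mpoly])

lemma dehom_single: "dehom v (Poly_Mapping.single m c) = Poly_Mapping.single (drop_var v m) c"
  by (simp add: dehom_def lin_ext_single scal_single)

lemma homog_single:
  "homog v t (Poly_Mapping.single m c) = Poly_Mapping.single (m + Poly_Mapping.single v (t - mdeg m)) c"
  by (simp add: homog_def lin_ext_single scal_single)

lemma dehom_0 [simp]: "dehom v 0 = 0"
  by (metis dehom_single single_zero)

lemma dehom_sum: "dehom v (sum f A) = (\<Sum>a\<in>A. dehom v (f a))"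
  by (induction A rule: infinite_finite_induct) (auto simp: dehom_add)

text \<open>Substitution is multiplicative because \<open>drop_var\<close> is additive on exponent
  vectors.\<close>

lemma dehom_mult: "dehom v (p * q) = dehom v p * dehom v q"
proof (induction p rule: mpoly_induct)
  case (single m c)
  show ?case
    by (induction q rule: mpoly_induct)
      (simp_all add: mult_single dehom_single drop_var_add dehom_add distrib_left)
qed (simp add: dehom_add distrib_right)

lemma dehom_var_self: "dehom v (var v) = 1"
proof -
  have "drop_var v (Poly_Mapping.single v 1) = 0"
    by (rule poly_mapping_eqI) (simp add: lookup_drop_var lookup_single)
  then show ?thesis by (simp add: var_def dehom_single)
qed

lemma dehom_id:
  assumes "p \<in> carrier (polys W)" "v \<notin> W"
  shows "dehom v p = p"
  using linear_eq_supported[OF linear_dehom K.linear_id, of "monoms W" v p] assms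
  by (simp add: carrier_polys dehom_single drop_var_id)

lemma dehom_carrier:
  assumes "p \<in> carrier (polys (insert v W))" shows "dehom v p \<in> carrier (polys W)"
  unfolding carrier_polys
  by (rule linear_image_supported[OF linear_dehom _ subspace_supported assms[unfolded carrier_polys]])
     (simp add: dehom_single single_supported drop_var_monoms)

context
  fixes v :: nat and W :: "nat set"
  assumes v: "v \<notin> W"
begin

lemma dehom_form_lowdeg:
  assumes "f \<in> forms (insert v W) t" shows "dehom v f \<in> lowdeg W t"
  unfolding lowdeg_def
proof (rule linear_image_supported[OF linear_dehom _ subspace_supported assms[unfolded forms_supported]])
  fix m assume "m \<in> {m \<in> monoms (insert v W). mdeg m = t}"
  then show "dehom v (Poly_Mapping.single m 1) \<in> supported {m \<in> monoms W. mdeg m \<le> t}"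
    unfolding dehom_single using mdeg_drop_var[of v m]
    by (intro single_supported) (auto intro: drop_var_monoms)
qed

lemma homog_lowdeg_form:
  assumes "q \<in> lowdeg W t" shows "homog v t q \<in> forms (insert v W) t"
  unfolding forms_supported
proof (rule linear_image_supported[OF linear_homog _ subspace_supported assms[unfolded lowdeg_def]])
  fix m assume "m \<in> {m \<in> monoms W. mdeg m \<le> t}"
  then show "homog v t (Poly_Mapping.single m 1) \<in> supported {m \<in> monoms (insert v W). mdeg m = t}"
    unfolding homog_single
    by (intro single_supported) (auto intro!: monoms_add simp: mdeg_add, auto simp: monoms_def)
qed

lemma dehom_homog:
  assumes "q \<in> lowdeg W t" shows "dehom v (homog v t q) = q"
proof -
  have "(dehom v \<circ> homog v t) q = id q"
  proof (rule linear_eq_supported[OF Vector_Spaces.linear_compose[OF linear_homog linear_dehom] K.linear_id _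
        assms[unfolded lowdeg_def]])
    fix m assume m: "m \<in> {m \<in> monoms W. mdeg m \<le> t}"
    have "drop_var v (Poly_Mapping.single v k) = 0" for k
      by (rule poly_mapping_eqI) (simp add: lookup_drop_var lookup_single when_def)
    then show "(dehom v \<circ> homog v t) (Poly_Mapping.single m 1) = id (Poly_Mapping.single m 1)"
      using m v drop_var_id[of m W v] by (simp add: homog_single dehom_single drop_var_add)
  qed
  then show ?thesis by simp
qed

lemma homog_dehom:
  assumes "f \<in> forms (insert v W) t" shows "homog v t (dehom v f) = f"
proof -
  have "(homog v t \<circ> dehom v) f = id f"
  proof (rule linear_eq_supported[OF Vector_Spaces.linear_compose[OF linear_dehom linear_homog] K.linear_id _
        assms[unfolded forms_supported]])
    fix m assume m: "m \<in> {m \<in> monoms (insert v W). mdeg m = t}"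
    then have "t - mdeg (drop_var v m) = Poly_Mapping.lookup m v"
      using mdeg_drop_var[of v m] by simp
    then show "(homog v t \<circ> dehom v) (Poly_Mapping.single m 1) = id (Poly_Mapping.single m 1)"
      by (simp add: homog_single dehom_single drop_var_decomp)
  qed
  then show ?thesis by simp
qed

lemma dehom_forms: "dehom v ` forms (insert v W) t = lowdeg W t"
proof (intro equalityI subsetI)
  fix q :: "'a mpoly" assume "q \<in> lowdeg W t"
  then show "q \<in> dehom v ` forms (insert v W) t"
    using dehom_homog homog_lowdeg_form by (metis imageI)
qed (auto intro: dehom_form_lowdeg)

lemma inj_on_dehom: "inj_on (dehom v) (forms (insert v W) t)"
  by (rule inj_on_inverseI) (rule homog_dehom)

end

text \<open>The condition is imposed on each homogeneous component separately, which makes the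
  result homogeneous even if the single \<open>D t\<close> are not.\<close>

definition stacked_ideal :: "nat \<Rightarrow> nat set \<Rightarrow> (nat \<Rightarrow> 'k::field mpoly set) \<Rightarrow> 'k mpoly set" where
  "stacked_ideal v W D = {p \<in> carrier (polys (insert v W)). \<forall>t. dehom v (hcomp t p) \<in> D t}"

context
  fixes v :: nat and W :: "nat set" and D :: "nat \<Rightarrow> 'k::field mpoly set"
  assumes v: "v \<notin> W" and W: "finite W" and D: "\<And>t. ideal (D t) (polys W)" and mono: "mono D"
begin

text \<open>Component \<open>t\<close> of a product \<open>r * a\<close> is a sum of products with
  components of \<open>a\<close> of degree \<open>t - i\<close>. These dehomogenize into
  \<open>D (t - i)\<close>, and monotonicity moves them to \<open>D t\<close>.\<close>

lemma stacked_ideal_ideal: "ideal (stacked_ideal v W D) (polys (insert v W))"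
proof (rule ideal_polysI)
  show "0 \<in> stacked_ideal v W D"
    using K.subspace_0[OF carrier_subspace] ideal_polysD(2)[OF D] by (simp add: stacked_ideal_def)
  show "a + b \<in> stacked_ideal v W D" if "a \<in> stacked_ideal v W D" "b \<in> stacked_ideal v W D" for a b
    using that ideal_polysD(3)[OF D]
    by (simp add: stacked_ideal_def hcomp_add dehom_add K.subspace_add[OF carrier_subspace])
  show "r * a \<in> stacked_ideal v W D" if r: "r \<in> carrier (polys (insert v W))" and a: "a \<in> stacked_ideal v W D" for r a
  proof -
    have "dehom v (hcomp t (r * a)) \<in> D t" for t
    proof -
      have "dehom v (hcomp i r) * dehom v (hcomp (t - i) a) \<in> D t" if "i \<le> t" for i
      proof -
        have "dehom v (hcomp (t - i) a) \<in> D t"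
          using a monoD[OF mono, of "t - i" t] by (auto simp: stacked_ideal_def)
        moreover have "dehom v (hcomp i r) \<in> carrier (polys W)"
          using hcomp_forms[OF r] forms_carrier dehom_carrier by blast
        ultimately show ?thesis using ideal_polysD(4)[OF D] by blast
      qed
      then show ?thesis unfolding hcomp_mult dehom_sum dehom_mult
        by (intro K.subspace_sum[OF ideal_subspace[OF D]]) auto
    qed
    then show ?thesis using polys_mult_closed[OF r] a by (simp add: stacked_ideal_def)
  qed
qed (auto simp: stacked_ideal_def)

lemma form_in_stacked_ideal:
  assumes "f \<in> forms (insert v W) t"
  shows "f \<in> stacked_ideal v W D \<longleftrightarrow> dehom v f \<in> D t"
  using assms forms_carrier[of "insert v W" t] ideal_polysD(2)[OF D]
  by (auto simp: stacked_ideal_def hcomp_of_form)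

lemma stacked_ideal_homogeneous: "homogeneous_ideal (insert v W) (stacked_ideal v W D)"
proof -
  have "hcomp t p \<in> stacked_ideal v W D" if "p \<in> stacked_ideal v W D" for p t
  proof -
    have "hcomp t p \<in> forms (insert v W) t" using that hcomp_forms by (auto simp: stacked_ideal_def)
    then show ?thesis using form_in_stacked_ideal that by (auto simp: stacked_ideal_def)
  qed
  then show ?thesis unfolding homogeneous_ideal_def using stacked_ideal_ideal by blast
qed

text \<open>On forms of one fixed degree \<open>dehom v\<close> is injective, and it turns
  membership in the stacked ideal into membership in \<open>D t\<close>; so it preserves the
  dimension of \<open>U\<close> and of its intersection with the ideal.\<close>

lemma rdim_stacked_ideal:
  assumes "K.subspace U" "U \<subseteq> forms (insert v W) t"
  shows "K.rdim (stacked_ideal v W D) U = K.rdim (D t) (dehom v ` U)"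
proof -
  have fU: "K.findim U"
    using K.findim_subset[OF findim_forms assms] W by simp
  have fI: "K.findim (U \<inter> stacked_ideal v W D)"
    using K.findim_subset[OF fU K.subspace_inter[OF assms(1) ideal_subspace[OF stacked_ideal_ideal]]] by simp
  have inj: "inj_on (dehom v) U" using inj_on_subset[OF inj_on_dehom[OF v] assms(2)] .
  have "dehom v ` (U \<inter> stacked_ideal v W D) = dehom v ` U \<inter> D t"
    using form_in_stacked_ideal assms(2) by blast
  then show ?thesis unfolding K.rdim_def
    using K.dim_image_inj[OF linear_dehom inj fU]
      K.dim_image_inj[OF linear_dehom inj_on_subset[OF inj] fI] by simp
qed

lemma stacked_ideal_hilbert_rdim: "hilbert_function (insert v W) (stacked_ideal v W D) t = K.rdim (D t) (lowdeg W t)"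
  using rdim_stacked_ideal[OF forms_subspace order_refl, of t] W
  by (simp add: hilbert_function_rdim[OF stacked_ideal_ideal] dehom_forms[OF v])

text \<open>The products \<open>v * f\<close> have degree \<open>t + 1\<close> but the same
  dehomogenization as \<open>f\<close>: the space is still \<open>lowdeg W t\<close>, now taken
  modulo \<open>D (t + 1)\<close>.\<close>

lemma stacked_ideal_rank_rdim:
  "K.rdim (stacked_ideal v W D) ((*) (var v) ` forms (insert v W) t) = K.rdim (D (t + 1)) (lowdeg W t)"
proof -
  have "dehom v ` (*) (var v) ` forms (insert v W) t = (lowdeg W t :: 'k mpoly set)"
    unfolding dehom_forms[OF v, symmetric] by (simp add: image_image dehom_mult dehom_var_self)
  moreover have "K.subspace ((*) (var v) ` forms (insert v W) t :: 'k mpoly set)"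
    using K.findim_image[OF linear_mult findim_forms] K.findim_subspace W by blast
  moreover have "(*) (var v) ` forms (insert v W) t \<subseteq> (forms (insert v W) (t + 1) :: 'k mpoly set)"
    using forms_mult[OF var_forms, of v "insert v W" _ t] by auto
  ultimately show ?thesis using rdim_stacked_ideal by metis
qed

text \<open>The condition for \<open>v\<close> itself puts \<open>dehom v f\<close> into
  \<open>D (t + 1)\<close>; since this is an ideal, the conditions for the other variables follow.
  What remains is the kernel of the passage from \<open>D t\<close> to
  \<open>D (t + 1)\<close>.\<close>

lemma stacked_ideal_socle_rdim:
  "socle_dim (insert v W) (stacked_ideal v W D) t = K.rdim (D t) (lowdeg W t) - K.rdim (D (t + 1)) (lowdeg W t)"
proof -
  let ?S = "{f \<in> forms (insert v W) t. \<forall>x\<in>insert v W. var x * f \<in> stacked_ideal v W D}"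
  have "(\<forall>x\<in>insert v W. var x * f \<in> stacked_ideal v W D) \<longleftrightarrow> dehom v f \<in> D (t + 1)"
    if f: "f \<in> forms (insert v W) t" for f
  proof -
    have "var x * f \<in> stacked_ideal v W D \<longleftrightarrow> dehom v (var x) * dehom v f \<in> D (t + 1)" if x: "x \<in> insert v W" for x
      using form_in_stacked_ideal[of "var x * f" "t + 1"] forms_mult[OF var_forms[OF x] f]
      by (simp add: dehom_mult)
    moreover have "dehom v (var x) \<in> carrier (polys W)" if "x \<in> insert v W" for x
      using that var_carrier dehom_carrier by blast
    ultimately show ?thesis
      using ideal_polysD(4)[OF D] by (metis dehom_var_self insertI1 mult_1)
  qed
  then have S: "?S = {f \<in> forms (insert v W) t. dehom v f \<in> D (t + 1)}" by blast
  have img: "dehom v ` ?S = lowdeg W t \<inter> D (t + 1)"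
    unfolding S dehom_forms[OF v, symmetric] by blast
  have "K.subspace {f. dehom v f \<in> D (t + 1)}"
    using ideal_subspace[OF D, of "t + 1"] unfolding K.subspace_def
    by (simp add: linear_dehom[unfolded linear_iff_mpoly])
  then have "K.subspace (forms (insert v W) t \<inter> {f. dehom v f \<in> D (t + 1)})"
    by (rule K.subspace_inter[OF forms_subspace])
  moreover have "forms (insert v W) t \<inter> {f. dehom v f \<in> D (t + 1)} = ?S" unfolding S by blast
  ultimately have "K.subspace ?S" by simp
  then have "K.rdim (stacked_ideal v W D) ?S = K.rdim (D t) (lowdeg W t \<inter> D (t + 1))"
    using rdim_stacked_ideal[of ?S t] img by auto
  also have "\<dots> = K.rdim (D t) (lowdeg W t) - K.rdim (D (t + 1)) (lowdeg W t)"
    using monoD[OF mono, of t "t + 1"]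
    by (intro K.rdim_Int_mono findim_lowdeg W ideal_subspace[OF D]) auto
  finally show ?thesis using socle_dim_rdim[OF stacked_ideal_ideal] W by simp
qed

end

section \<open>Hilbert function, Lefschetz property and socle of stacked ideals\<close>

lemma high_degree_subset:
  fixes J :: "'k::field mpoly set"
  assumes "K.subspace J" "\<And>t. t > s \<Longrightarrow> forms V t \<subseteq> J"
  shows "supported {m \<in> monoms V. mdeg m > s} \<subseteq> J"
proof
  fix b :: "'k mpoly" assume b: "b \<in> supported {m \<in> monoms V. mdeg m > s}"
  then have bc: "b \<in> carrier (polys V)"
    unfolding carrier_polys using supported_mono[of "{m \<in> monoms V. mdeg m > s}" "monoms V"] by auto
  obtain N where "b \<in> lowdeg V N" using carrier_lowdeg[OF bc] .
  then have "b = (\<Sum>t\<le>N. hcomp t b)" by (rule lowdeg_decomposition)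
  moreover have "hcomp t b \<in> J" for t
  proof (cases "t > s")
    case True
    then show ?thesis using hcomp_forms[OF bc] assms(2) by blast
  next
    case False
    then have "hcomp t b = 0"
      using b by (intro poly_mapping_eqI) (auto simp: lookup_hcomp supported_iff)
    then show ?thesis using K.subspace_0[OF assms(1)] by simp
  qed
  ultimately show "b \<in> J" using K.subspace_sum[OF assms(1)] by metis
qed

text \<open>Cutting off all terms of degree above \<open>s\<close> changes a polynomial by an
  element of \<open>J\<close>. This supplies the finite-dimensional space of representatives for
  Artinian quotients.\<close>

lemma truncation:
  assumes "K.subspace J" "\<And>t. t > s \<Longrightarrow> forms V t \<subseteq> J" "p \<in> carrier (polys V)"
  shows "\<exists>q\<in>lowdeg V s. p - q \<in> J"
proof -
  have "monoms V = {m \<in> monoms V. mdeg m \<le> s} \<union> {m \<in> monoms V. mdeg m > s}" by auto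
  then have "p \<in> supported ({m \<in> monoms V. mdeg m \<le> s} \<union> {m \<in> monoms V. mdeg m > s})"
    using assms(3) by (simp add: carrier_polys)
  then obtain a b where "a \<in> lowdeg V s" "b \<in> supported {m \<in> monoms V. mdeg m > s}" "p = a + b"
    unfolding lowdeg_def by (rule supported_Un)
  then show ?thesis using high_degree_subset[OF assms(1,2)] by (intro bexI[of _ a]) auto
qed

lemma hilbert_function_eq_0_iff:
  assumes "finite V" "ideal J (polys V)"
  shows "hilbert_function V J t = 0 \<longleftrightarrow> forms V t \<subseteq> J"
  by (simp add: hilbert_function_rdim assms K.rdim_eq_0_iff findim_forms ideal_subspace[OF assms(2)])

lemma artinian_if_hilbert_function_vanishes:
  assumes "finite V" "ideal J (polys V)" "\<And>t. t > s \<Longrightarrow> hilbert_function V J t = 0"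
  shows "artinian_ring (polys V Quot J)"
proof (rule artinian_Quot[OF assms(2) findim_lowdeg[OF assms(1)] lowdeg_carrier])
  show "\<exists>q\<in>lowdeg V s. p - q \<in> J" if "p \<in> carrier (polys V)" for p
    using truncation[OF ideal_subspace[OF assms(2)] _ that] assms hilbert_function_eq_0_iff by blast
qed

text \<open>For a homogeneous ideal the dimension in degrees up to \<open>t\<close> is the sum of
  the values of the Hilbert function.\<close>

lemma rdim_lowdeg_Suc:
  assumes "finite V" "homogeneous_ideal V J"
  shows "K.rdim J (lowdeg V (Suc t)) = K.rdim J (lowdeg V t) + K.rdim J (forms V (Suc t))"
proof -
  have J: "ideal J (polys V)" and hJ: "\<And>p t. p \<in> J \<Longrightarrow> hcomp t p \<in> J"
    using assms(2) by (auto simp: homogeneous_ideal_def)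
  let ?A = "{m \<in> monoms V. mdeg m \<le> t}" and ?B = "{m \<in> monoms V. mdeg m = Suc t}"
  have AB: "{m \<in> monoms V. mdeg m \<le> Suc t} = ?A \<union> ?B" by auto
  have "lowdeg V (Suc t) = {a + b |a b. a \<in> lowdeg V t \<and> b \<in> (forms V (Suc t) :: 'a mpoly set)}"
  proof (intro equalityI subsetI)
    fix x :: "'a mpoly" assume "x \<in> lowdeg V (Suc t)"
    then have "x \<in> supported (?A \<union> ?B)" by (simp add: lowdeg_def AB)
    then obtain a b where "a \<in> supported ?A" "b \<in> supported ?B" "x = a + b" by (rule supported_Un)
    then show "x \<in> {a + b |a b. a \<in> lowdeg V t \<and> b \<in> forms V (Suc t)}"
      by (auto simp: lowdeg_def forms_supported)
  next
    fix x :: "'a mpoly" assume "x \<in> {a + b |a b. a \<in> lowdeg V t \<and> b \<in> forms V (Suc t)}"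
    then obtain a b where "x = a + b" "a \<in> lowdeg V t" "b \<in> forms V (Suc t)" by blast
    moreover from this have "a \<in> lowdeg V (Suc t)" "b \<in> lowdeg V (Suc t)"
      using subsetD[OF lowdeg_mono[of t "Suc t" V]] subsetD[OF forms_lowdeg[of "Suc t" "Suc t" V]]
      by simp_all
    ultimately show "x \<in> lowdeg V (Suc t)"
      using K.subspace_add[OF subspace_supported] unfolding lowdeg_def by simp
  qed
  moreover have "K.rdim J {a + b |a b. a \<in> lowdeg V t \<and> b \<in> forms V (Suc t)}
      = K.rdim J (lowdeg V t) + K.rdim J (forms V (Suc t))"
  proof (rule K.rdim_direct_sum[OF findim_lowdeg findim_forms ideal_subspace[OF J]])
    show "(lowdeg V t :: 'a mpoly set) \<inter> forms V (Suc t) = {0}"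
      by (auto simp: lowdeg_def forms_supported supported_iff intro!: poly_mapping_eqI)
        (metis Suc_n_not_le_n)
  next
    fix a b assume ab: "a \<in> lowdeg V t" "b \<in> forms V (Suc t)" "a + b \<in> J"
    \<comment> \<open>The components of degree at most \<open>t\<close> of \<open>a + b\<close> lie
      in \<open>J\<close> and add up to \<open>a\<close>, as \<open>b\<close> lives in degree
      \<open>Suc t\<close>.\<close>
    have "(\<Sum>i\<le>t. hcomp i (a + b)) \<in> J"
      by (intro K.subspace_sum[OF ideal_subspace[OF J]] hJ ab)
    also have "(\<Sum>i\<le>t. hcomp i (a + b)) = (\<Sum>i\<le>t. hcomp i a)"
      using ab(2) by (intro sum.cong) (auto simp: hcomp_add hcomp_of_form)
    also have "\<dots> = a" using lowdeg_decomposition[OF ab(1)] by simp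
    finally show "a \<in> J" .
  qed (use assms in auto)
  ultimately show ?thesis by simp
qed

lemma lowdeg_0: "lowdeg V 0 = forms V 0"
  by (simp add: lowdeg_def forms_supported)

text \<open>The sum of the differences telescopes: up to \<open>k\<close> the sequence does not
  decrease, so truncated subtraction loses nothing.\<close>

lemma rdim_lowdeg_pos_diff:
  assumes "finite V" "homogeneous_ideal V J" "hilbert_function V J = pos_diff h"
    and inc: "\<And>t. t < k \<Longrightarrow> h t \<le> h (t + 1)" and "t \<le> k"
  shows "K.rdim J (lowdeg V t) = h t"
  using \<open>t \<le> k\<close>
proof (induction t)
  case 0
  have "ideal J (polys V)" using assms(2) by (simp add: homogeneous_ideal_def)
  then show ?case
    using fun_cong[OF assms(3), of 0] by (simp add: lowdeg_0 hilbert_function_rdim assms(1) pos_diff_def)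
next
  case (Suc t)
  have "ideal J (polys V)" using assms(2) by (simp add: homogeneous_ideal_def)
  then have "K.rdim J (forms V (Suc t)) = h (Suc t) - h t"
    using fun_cong[OF assms(3), of "Suc t"] by (simp add: hilbert_function_rdim assms(1) pos_diff_def)
  then show ?case using Suc inc[of t] by (simp add: rdim_lowdeg_Suc[OF assms(1,2)])
qed

section \<open>Increasing families of ideals that are constant up to the peak
  \<open>k\<close>\<close>

context
  fixes v k :: nat and W :: "nat set" and D :: "nat \<Rightarrow> 'k::field mpoly set" and h :: "nat \<Rightarrow> nat"
  assumes v: "v \<notin> W" and W: "finite W" and D: "\<And>t. ideal (D t) (polys W)" and mono: "mono D"
    and D0: "homogeneous_ideal W (D 0)" "\<And>t. t \<le> k \<Longrightarrow> D t = D 0"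
    and hD0: "hilbert_function W (D 0) = pos_diff h"
    and high: "\<And>t. t > k \<Longrightarrow> K.rdim (D t) (lowdeg W k) = h t"
    and inc: "\<And>t. t < k \<Longrightarrow> h t \<le> h (t + 1)"
    and dec: "\<And>t. t \<ge> k \<Longrightarrow> h (t + 1) \<le> h t"
begin

text \<open>Past the peak \<open>pos_diff h\<close> is 0, so these forms lie in \<open>D 0\<close>
  and by monotonicity in every \<open>D t\<close>.\<close>

lemma high_forms: "i > k \<Longrightarrow> forms W i \<subseteq> D t"
proof -
  assume i: "i > k"
  then have "h i \<le> h (i - 1)" using dec[of "i - 1"] by simp
  then have "hilbert_function W (D 0) i = 0"
    using i by (cases i) (simp_all add: hD0 pos_diff_def)
  then show ?thesis
    using hilbert_function_eq_0_iff[OF W D] monoD[OF mono, of 0 t] by auto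
qed

text \<open>Every degree bound from \<open>k\<close> on yields the whole quotient by
  \<open>D t\<close>.\<close>

lemma rdim_lowdeg_peak:
  assumes "j \<ge> k" shows "K.rdim (D t) (lowdeg W j) = K.rdim (D t) (lowdeg W k)"
proof -
  have "K.rdim (D t) (lowdeg W k) = K.rdim (D t) (lowdeg W j)"
  proof (rule K.rdim_eqI[OF findim_lowdeg ideal_subspace[OF D]])
    show "\<exists>y\<in>lowdeg W k. x - y \<in> D t" if "x \<in> lowdeg W j" for x
      using truncation[OF ideal_subspace[OF D] high_forms subsetD[OF lowdeg_carrier that]] .
  qed (use W assms lowdeg_mono in \<open>auto simp: lowdeg_def subspace_supported\<close>)
  then show ?thesis by simp
qed

lemma rdim_lowdeg_h: "K.rdim (D t) (lowdeg W t) = h t"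
proof (cases "t \<le> k")
  case True
  then show ?thesis using rdim_lowdeg_pos_diff[OF W D0(1) hD0 inc True] D0(2)[OF True] by simp
next
  case False
  then show ?thesis using rdim_lowdeg_peak[of t t] high by simp
qed

text \<open>Before the peak \<open>D (t + 1) = D t\<close>, so nothing is lost and the rank is
  \<open>h t\<close>. From the peak on, degrees up to \<open>t\<close> and up to
  \<open>t + 1\<close> have the same image modulo \<open>D (t + 1)\<close>, so the rank is
  \<open>h (t + 1)\<close>.\<close>

lemma rdim_lowdeg_rank: "K.rdim (D (t + 1)) (lowdeg W t) = min (h t) (h (t + 1))"
proof (cases "t < k")
  case True
  then have "D (t + 1) = D t" using D0(2)[of t] D0(2)[of "t + 1"] by (metis Suc_eq_plus1 Suc_leI less_imp_le)
  then show ?thesis using rdim_lowdeg_h[of t] inc[OF True] by simp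
next
  case False
  then have "K.rdim (D (t + 1)) (lowdeg W t) = K.rdim (D (t + 1)) (lowdeg W (t + 1))"
    using rdim_lowdeg_peak[of t "t + 1"] rdim_lowdeg_peak[of "t + 1" "t + 1"] by simp
  then show ?thesis using rdim_lowdeg_h[of "t + 1"] dec[of t] False by simp
qed

lemma stacked_ideal_hilbert: "hilbert_function (insert v W) (stacked_ideal v W D) = h"
  using stacked_ideal_hilbert_rdim[OF v W D mono] rdim_lowdeg_h by auto

lemma stacked_ideal_lefschetz: "weak_lefschetz (insert v W) (stacked_ideal v W D)"
  unfolding weak_lefschetz_rdim[OF stacked_ideal_ideal[OF v W D mono] finite.insertI[OF W]]
    stacked_ideal_rank_rdim[OF v W D mono, symmetric] stacked_ideal_hilbert
  using stacked_ideal_rank_rdim[OF v W D mono] rdim_lowdeg_rank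
  by (intro bexI[of _ "var v"] var_forms) auto

text \<open>The kernel of multiplication by \<open>v\<close> has dimension
  \<open>h t - min (h t) (h (t + 1))\<close>, which is the truncated difference.\<close>

lemma stacked_ideal_socle:
  "socle_dim (insert v W) (stacked_ideal v W D) t = h t - h (t + 1)"
  unfolding stacked_ideal_socle_rdim[OF v W D mono] rdim_lowdeg_h rdim_lowdeg_rank by simp

lemma stacked_ideal_artinian:
  assumes "\<And>t. t > s \<Longrightarrow> h t = 0"
  shows "homogeneous_artinian_ideal (insert v W) (stacked_ideal v W D)"
  unfolding homogeneous_artinian_ideal_def
  using stacked_ideal_homogeneous[OF v W D mono] stacked_ideal_hilbert assms W
    artinian_if_hilbert_function_vanishes[OF _ stacked_ideal_ideal[OF v W D mono], of s] by auto

end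

section \<open>Chains of ideals whose codimension drops by one\<close>

lemma mdeg_eq_0: "mdeg m = 0 \<Longrightarrow> m = 0"
  by (intro poly_mapping_eqI) (auto simp: mdeg_def in_keys_iff)

text \<open>A form of maximal degree outside \<open>J\<close> is a socle element modulo \<open>J\<close>, so adjoining it as a
  vector already gives an ideal.\<close>

lemma ideal_enlarge:
  fixes J :: "'k::field mpoly set"
  assumes W: "finite W" and J: "ideal J (polys W)" and high: "\<And>t. t > k \<Longrightarrow> forms W t \<subseteq> J"
    and d: "K.rdim J (lowdeg W k) = Suc d"
  shows "\<exists>J'. ideal J' (polys W) \<and> J \<subseteq> J' \<and> K.rdim J' (lowdeg W k) = d"
proof -
  have sJ: "K.subspace J" using ideal_subspace[OF J] .
  define P :: "'k mpoly set" where "P = lowdeg W k"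
  have fP: "K.findim P" and sP: "K.subspace P"
    using findim_lowdeg[OF W] by (auto simp: P_def lowdeg_def subspace_supported)
  \<comment> \<open>Otherwise all of \<open>lowdeg W k\<close> would lie in \<open>J\<close> and the
    codimension would be 0 instead of \<open>Suc d\<close>.\<close>
  have "\<exists>j. \<not> forms W j \<subseteq> J"
  proof (rule ccontr)
    assume "\<nexists>j. \<not> forms W j \<subseteq> J"
    then have "P \<subseteq> J"
      using lowdeg_decomposition K.subspace_sum[OF sJ] hcomp_forms lowdeg_carrier
      unfolding P_def by (metis (no_types, lifting) subset_eq)
    then show False using d K.rdim_eq_0_iff[OF fP sJ] by (simp add: P_def)
  qed
  moreover have bnd: "\<forall>j. \<not> forms W j \<subseteq> J \<longrightarrow> j \<le> k" using high not_le by blast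
  \<comment> \<open>The degrees of forms outside \<open>J\<close> are bounded by \<open>k\<close>,
    so there is a largest one.\<close>
  ultimately obtain j where j: "\<not> forms W j \<subseteq> J" "\<And>i. \<not> forms W i \<subseteq> J \<Longrightarrow> i \<le> j"
    using Greatest_le_nat[of "\<lambda>j. \<not> forms W j \<subseteq> J" _ k] GreatestI_nat[of "\<lambda>j. \<not> forms W j \<subseteq> J" _ k] by metis
  then obtain f where f: "f \<in> forms W j" "f \<notin> J" by blast
  have fPin: "f \<in> P" using f(1) bnd j(1) forms_lowdeg[of j k W] by (auto simp: P_def)
  have higher: "supported {m \<in> monoms W. mdeg m > j} \<subseteq> J"
    using j(2) not_le by (intro high_degree_subset sJ) blast
  define J' where "J' = {a + b |a b. a \<in> J \<and> b \<in> K.span {f}}"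
  have sJ': "K.subspace J'" unfolding J'_def by (intro K.subspace_sums sJ) simp
  have JJ': "J \<subseteq> J'" unfolding J'_def using K.span_zero[of "{f}"] by force
  have fJ': "f \<in> J'" unfolding J'_def using K.subspace_0[OF sJ] K.span_base[of f "{f}"] by force
  \<comment> \<open>Split \<open>r\<close> into its constant term and a part of positive degree: the
    first only scales \<open>f\<close>, the second pushes \<open>f\<close> beyond degree
    \<open>j\<close> and hence into \<open>J\<close>.\<close>
  have rf: "r * f \<in> J'" if r: "r \<in> carrier (polys W)" for r
  proof -
    have "monoms W = {0} \<union> {m \<in> monoms W. mdeg m > 0}" using mdeg_eq_0 by auto
    then have "r \<in> supported ({0} \<union> {m \<in> monoms W. mdeg m > 0})" using r by (simp add: carrier_polys)
    then obtain a b where ab: "a \<in> supported {0}" "b \<in> supported {m \<in> monoms W. mdeg m > 0}" "r = a + b"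
      by (rule supported_Un)
    have "a = scal (Poly_Mapping.lookup a 0) 1"
      using ab(1) by (intro poly_mapping_eqI) (auto simp: supported_iff lookup_scal lookup_one when_def)
    then have "a * f = scal (Poly_Mapping.lookup a 0) f" by (metis mult_1 scal_mult_left)
    then have "a * f \<in> J'" using K.subspace_scale[OF sJ' fJ'] by simp
    moreover have "b * f \<in> supported {m \<in> monoms W. mdeg m > j}"
      using ab(2) f(1) unfolding forms_supported
      by (rule supported_mult) (auto intro: monoms_add simp: mdeg_add)
    ultimately show ?thesis using higher JJ' K.subspace_add[OF sJ'] ab(3) by (auto simp: distrib_right)
  qed
  have "ideal J' (polys W)"
  proof (rule ideal_polysI)
    have "K.span {f} \<subseteq> carrier (polys W)"
      using f(1) forms_carrier by (intro K.span_minimal carrier_subspace) auto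
    then show "J' \<subseteq> carrier (polys W)"
      unfolding J'_def using ideal_polysD(1)[OF J] K.subspace_add[OF carrier_subspace] by blast
    show "0 \<in> J'" using K.subspace_0[OF sJ'] .
    show "a + b \<in> J'" if "a \<in> J'" "b \<in> J'" for a b using that K.subspace_add[OF sJ'] by blast
    show "r * a \<in> J'" if r: "r \<in> carrier (polys W)" and a: "a \<in> J'" for r a
    proof -
      obtain x c where "a = x + scal c f" "x \<in> J" using a by (auto simp: J'_def K.span_singleton)
      then show ?thesis
        using subsetD[OF JJ' ideal_polysD(4)[OF J r]] rf[OF r]
        by (simp add: distrib_left scal_mult_right K.subspace_add[OF sJ'] K.subspace_scale[OF sJ'])
    qed
  qed
  moreover have "K.rdim J' P = d"
  proof -
    \<comment> \<open>The modular law, available because \<open>f\<close> lies in \<open>P\<close>.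
      As \<open>f\<close> is outside \<open>J\<close>, the intersection with \<open>P\<close> grows
      by exactly one dimension.\<close>
    have "P \<inter> J' = {a + b |a b. a \<in> P \<inter> J \<and> b \<in> K.span {f}}"
    proof (intro equalityI subsetI)
      fix x assume "x \<in> P \<inter> J'"
      then obtain a b where x: "x = a + b" "a \<in> J" "b \<in> K.span {f}" "x \<in> P" unfolding J'_def by blast
      then have "b \<in> P" using K.subspace_scale[OF sP fPin] by (auto simp: K.span_singleton)
      then have "a \<in> P" using K.subspace_diff[OF sP x(4), of b] x(1) by simp
      then show "x \<in> {a + b |a b. a \<in> P \<inter> J \<and> b \<in> K.span {f}}" using x by blast
    next
      fix x assume "x \<in> {a + b |a b. a \<in> P \<inter> J \<and> b \<in> K.span {f}}"
      then obtain a b where x: "x = a + b" "a \<in> J" "b \<in> K.span {f}" "a \<in> P" by blast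
      then have "b \<in> P" using K.subspace_scale[OF sP fPin] by (auto simp: K.span_singleton)
      then show "x \<in> P \<inter> J'" unfolding J'_def using x K.subspace_add[OF sP] by blast
    qed
    moreover have "f \<noteq> 0" using f(2) K.subspace_0[OF sJ] by auto
    then have "K.dim (K.span {f}) = 1" by (simp add: K.dim_eq_card_independent)
    moreover have "P \<inter> J \<inter> K.span {f} = {0}"
    proof -
      have "c = 0" if "scal c f \<in> J" for c
      proof (rule ccontr)
        assume "c \<noteq> 0"
        then have "f = scal (inverse c) (scal c f)" by simp
        then show False using K.subspace_scale[OF sJ that] f(2) by metis
      qed
      then show ?thesis using K.subspace_0[OF sJ] K.subspace_0[OF sP] by (auto simp: K.span_singleton)
    qed
    moreover have "K.findim (P \<inter> J)"
      by (rule K.findim_subset[OF fP K.subspace_inter[OF sP sJ]]) simp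
    moreover have "K.findim (K.span {f})" unfolding K.findim_def by auto
    moreover have "K.dim {0 :: 'k mpoly} = 0" using K.dim_le_card[of "{0}" "{}"] by simp
    ultimately have "K.dim (P \<inter> J') = K.dim (P \<inter> J) + 1" using K.dim_sum[of "P \<inter> J" "K.span {f}"] by simp
    then show ?thesis using d unfolding K.rdim_def P_def[symmetric] by simp
  qed
  ultimately show ?thesis using JJ' by (auto simp: P_def)
qed

text \<open>Since the codimension drops by one at a time, every value from \<open>d\<close> down to
  0 occurs at a known index; the truncated \<open>d - i\<close> keeps it at 0 afterwards.\<close>

lemma ideal_chain_exists:
  fixes J :: "'k::field mpoly set"
  assumes W: "finite W" and "ideal J (polys W)" "\<And>t. t > k \<Longrightarrow> forms W t \<subseteq> J"
    and "K.rdim J (lowdeg W k) = d"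
  shows "\<exists>E. E 0 = J \<and> mono E \<and> (\<forall>i. ideal (E i) (polys W) \<and> K.rdim (E i) (lowdeg W k) = d - i)"
  using assms(2-)
proof (induction d arbitrary: J)
  case 0
  then show ?case by (intro exI[of _ "\<lambda>_. J"]) (auto simp: mono_def)
next
  case (Suc d)
  obtain J' where J': "ideal J' (polys W)" "J \<subseteq> J'" "K.rdim J' (lowdeg W k) = d"
    using ideal_enlarge[OF W Suc.prems] by blast
  obtain E where E: "E 0 = J'" "mono E"
    "\<forall>i. ideal (E i) (polys W) \<and> K.rdim (E i) (lowdeg W k) = d - i"
    using Suc.IH[OF J'(1) _ J'(3)] Suc.prems(2) J'(2) by blast
  let ?E = "\<lambda>i. case i of 0 \<Rightarrow> J | Suc i \<Rightarrow> E i"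
  have "mono ?E"
    unfolding mono_iff_le_Suc using E J' by (auto simp: mono_iff_le_Suc split: nat.splits)
  then show ?case using E Suc.prems by (intro exI[of _ ?E]) (auto split: nat.splits)
qed

section \<open>Quotients by a linear form\<close>

lemma monom_split:
  assumes "m \<in> monoms V" "mdeg m = Suc t"
  obtains i m' where "i \<in> V" "m' \<in> monoms V" "mdeg m' = t" "m = Poly_Mapping.single i 1 + m'"
proof -
  have "Poly_Mapping.keys m \<noteq> {}" using assms(2) by (auto simp: mdeg_def)
  then obtain i where i: "i \<in> Poly_Mapping.keys m" by blast
  define m' where "m' = m - Poly_Mapping.single i 1"
  have m: "m = Poly_Mapping.single i 1 + m'"
    using i unfolding m'_def
    by (intro poly_mapping_eqI) (auto simp: lookup_add lookup_minus lookup_single when_def in_keys_iff)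
  have "m' \<in> monoms V"
    using assms(1) unfolding m'_def monoms_def
    by (auto simp: in_keys_iff lookup_minus subset_iff)
  moreover have "mdeg m' = t" using arg_cong[OF m, of mdeg] assms(2) by (simp add: mdeg_add)
  ultimately show ?thesis using that i assms(1) m by (auto simp: monoms_def)
qed

text \<open>Every monomial of degree \<open>Suc t\<close> is a variable times a monomial of degree
  \<open>t\<close>.\<close>

lemma forms_Suc_subset:
  fixes J :: "'k::field mpoly set"
  assumes J: "ideal J (polys V)" and "forms V t \<subseteq> J"
  shows "forms V (Suc t) \<subseteq> J"
  unfolding forms_supported supported_span
proof (intro K.span_minimal ideal_subspace[OF J] image_subsetI)
  fix m assume "m \<in> {m \<in> monoms V. mdeg m = Suc t}"
  then obtain i m' where m: "i \<in> V" "m' \<in> monoms V" "mdeg m' = t" "m = Poly_Mapping.single i 1 + m'"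
    using monom_split by blast
  then have "Poly_Mapping.single m' 1 \<in> J"
    using assms(2) by (auto simp: forms_supported intro: single_supported)
  then have "var i * Poly_Mapping.single m' 1 \<in> J"
    using ideal_polysD(4)[OF J var_carrier[OF m(1)]] by blast
  then show "Poly_Mapping.single m 1 \<in> J" by (simp add: var_def mult_single m(4))
qed

lemma hcomp_mult_linear_form:
  assumes "g \<in> forms V 1"
  shows "hcomp t (g * b) = (case t of 0 \<Rightarrow> 0 | Suc i \<Rightarrow> g * hcomp i b)"
proof -
  have "hcomp t (g * b) = (\<Sum>i\<le>t. if i = 1 then g * hcomp (t - 1) b else 0)"
    unfolding hcomp_mult using assms by (intro sum.cong) (auto simp: hcomp_of_form)
  then show ?thesis by (auto split: nat.splits)
qed

text \<open>Factoring out \<open>g\<close> replaces each graded piece by the cokernel of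
  multiplication by \<open>g\<close>, so the Hilbert function drops by the rank.\<close>

lemma adjoin_linear_form:
  fixes J :: "'k::field mpoly set"
  assumes V: "finite V" and hJ: "homogeneous_ideal V J" and g: "g \<in> forms V 1"
  defines "J' \<equiv> {a + g * b |a b. a \<in> J \<and> b \<in> carrier (polys V)}"
  shows "homogeneous_ideal V J'"
    "hilbert_function V J' 0 = hilbert_function V J 0"
    "hilbert_function V J' (Suc i) = hilbert_function V J (Suc i) - K.rdim J ((*) g ` forms V i)"
proof -
  have J: "ideal J (polys V)" and hc: "\<And>p t. p \<in> J \<Longrightarrow> hcomp t p \<in> J"
    using hJ by (auto simp: homogeneous_ideal_def)
  note sJ = ideal_subspace[OF J]
  have gc: "g \<in> carrier (polys V)" using g forms_carrier by blast
  have J': "ideal J' (polys V)"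
  proof (rule ideal_polysI)
    show "J' \<subseteq> carrier (polys V)"
      unfolding J'_def using ideal_polysD(1)[OF J] polys_mult_closed[OF gc]
        K.subspace_add[OF carrier_subspace] by blast
    show "0 \<in> J'"
      unfolding J'_def using K.subspace_0[OF sJ] K.subspace_0[OF carrier_subspace, of V] by force
    show "x + y \<in> J'" if xy: "x \<in> J'" "y \<in> J'" for x y
    proof -
      obtain a b c d where "x = a + g * b" "y = c + g * d" "a \<in> J" "c \<in> J"
        "b \<in> carrier (polys V)" "d \<in> carrier (polys V)"
        using xy unfolding J'_def by blast
      then have "x + y = (a + c) + g * (b + d)" "a + c \<in> J" "b + d \<in> carrier (polys V)"
        using K.subspace_add[OF sJ, of a c] K.subspace_add[OF carrier_subspace, of b V d]
        by (simp_all add: algebra_simps)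
      then show ?thesis unfolding J'_def by blast
    qed
    show "r * x \<in> J'" if r: "r \<in> carrier (polys V)" and x: "x \<in> J'" for r x
    proof -
      obtain a b where "x = a + g * b" "a \<in> J" "b \<in> carrier (polys V)"
        using x unfolding J'_def by blast
      then have "r * x = r * a + g * (r * b)" "r * a \<in> J" "r * b \<in> carrier (polys V)"
        using ideal_polysD(4)[OF J r, of a] polys_mult_closed[OF r, of b]
        by (simp_all add: algebra_simps)
      then show ?thesis unfolding J'_def by blast
    qed
  qed
  have hcJ': "hcomp t (a + g * b) = hcomp t a + (case t of 0 \<Rightarrow> 0 | Suc i \<Rightarrow> g * hcomp i b)" for a b t
    by (simp add: hcomp_add hcomp_mult_linear_form[OF g])
  have "hcomp t x \<in> J'" if x: "x \<in> J'" for x t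
  proof -
    obtain a b where ab: "x = a + g * b" "a \<in> J" "b \<in> carrier (polys V)"
      using x unfolding J'_def by blast
    define c where "c = (case t of 0 \<Rightarrow> 0 | Suc i \<Rightarrow> hcomp i b)"
    have "c \<in> carrier (polys V)"
      using subsetD[OF forms_carrier hcomp_forms[OF ab(3)]]
      unfolding c_def by (simp add: K.subspace_0[OF carrier_subspace] split: nat.splits)
    moreover have "hcomp t x = hcomp t a + g * c" by (simp add: ab(1) hcJ' c_def split: nat.splits)
    ultimately show ?thesis unfolding J'_def using hc[OF ab(2)] by blast
  qed
  then show "homogeneous_ideal V J'" using J' by (simp add: homogeneous_ideal_def)
  have JJ': "J \<subseteq> J'"
    unfolding J'_def using K.subspace_0[OF carrier_subspace, of V] by force
  \<comment> \<open>Multiples of the linear form \<open>g\<close> have no component of degree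
    0.\<close>
  have "forms V 0 \<inter> J' = forms V 0 \<inter> J"
  proof (intro equalityI subsetI)
    fix x assume x: "x \<in> forms V 0 \<inter> J'"
    then obtain a b where "x = a + g * b" "a \<in> J" unfolding J'_def by blast
    then have "hcomp 0 x \<in> J" using hc[of a 0] by (simp add: hcJ')
    then show "x \<in> forms V 0 \<inter> J" using x by (auto simp: hcomp_of_form)
  qed (use JJ' in blast)
  then show "hilbert_function V J' 0 = hilbert_function V J 0"
    by (simp add: hilbert_function_rdim[OF J V] hilbert_function_rdim[OF J' V] K.rdim_def)
  define F A G :: "'k mpoly set" where "F = forms V (Suc i)" and "A = forms V (Suc i) \<inter> J" and "G = (*) g ` forms V i"
  have GF: "G \<subseteq> F" unfolding F_def G_def using forms_mult[OF g, of _ i] by auto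
  have sF: "K.subspace F" unfolding F_def by (rule forms_subspace)
  have fF: "K.findim F" unfolding F_def by (rule findim_forms[OF V])
  have fG: "K.findim G" unfolding G_def by (rule K.findim_image[OF linear_mult findim_forms[OF V]])
  have fA: "K.findim A" unfolding A_def
    by (rule K.findim_subset[OF findim_forms[OF V, of "Suc i"] K.subspace_inter[OF forms_subspace sJ]]) simp
  \<comment> \<open>Taking components of degree \<open>Suc i\<close> replaces an arbitrary cofactor
    \<open>b\<close> by its component of degree \<open>i\<close>.\<close>
  have FJ': "F \<inter> J' = {a + b |a b. a \<in> A \<and> b \<in> G}"
  proof (intro equalityI subsetI)
    fix x assume x: "x \<in> F \<inter> J'"
    then obtain a b where ab: "x = a + g * b" "a \<in> J" "b \<in> carrier (polys V)" unfolding J'_def by blast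
    have "x = hcomp (Suc i) x" using x by (auto simp: F_def hcomp_of_form)
    also have "\<dots> = hcomp (Suc i) a + g * hcomp i b" by (simp add: ab(1) hcJ')
    finally have "x = hcomp (Suc i) a + g * hcomp i b" .
    moreover have "hcomp (Suc i) a \<in> A"
      unfolding A_def using hc[OF ab(2)] hcomp_forms subsetD[OF ideal_polysD(1)[OF J] ab(2)] by blast
    moreover have "g * hcomp i b \<in> G" unfolding G_def using hcomp_forms[OF ab(3)] by blast
    ultimately show "x \<in> {a + b |a b. a \<in> A \<and> b \<in> G}" by blast
  next
    fix x assume "x \<in> {a + b |a b. a \<in> A \<and> b \<in> G}"
    then obtain a b where ab: "x = a + b" "a \<in> A" "b \<in> G" by blast
    then obtain c where "b = g * c" "c \<in> forms V i" unfolding G_def by blast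
    then have "x \<in> J'" using ab subsetD[OF forms_carrier, of c V i] unfolding J'_def A_def by blast
    moreover have "x \<in> F" using ab GF K.subspace_add[OF sF] by (auto simp: A_def F_def)
    ultimately show "x \<in> F \<inter> J'" by blast
  qed
  \<comment> \<open>The overlap in the dimension formula is exactly what \<open>rdim J G\<close>
    subtracts from \<open>dim G\<close>; the ideal thus grows in this degree by the rank of
    multiplication by \<open>g\<close>.\<close>
  have "A \<inter> G = G \<inter> J" using GF by (auto simp: A_def F_def)
  then have "K.dim (F \<inter> J') + K.dim (G \<inter> J) = K.dim A + K.dim G"
    unfolding FJ' using K.dim_sum[OF fA fG] by simp
  then have "K.dim (F \<inter> J') = K.dim A + K.rdim J G"
    using K.dim_eq_rdim_add[OF fG sJ] by linarith
  then show "hilbert_function V J' (Suc i) = hilbert_function V J (Suc i) - K.rdim J ((*) g ` forms V i)"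
    unfolding hilbert_function_rdim[OF J V] hilbert_function_rdim[OF J' V] K.rdim_def
      F_def[symmetric] G_def[symmetric]
    by (simp add: A_def F_def[symmetric] K.rdim_def)
qed

section \<open>Both directions of the characterization\<close>

lemma lefschetz_imp_sequences:
  fixes J :: "'k::field mpoly set"
  assumes V: "finite V" and hJ: "homogeneous_ideal V J" and hf: "hilbert_function V J = h"
    and wl: "weak_lefschetz V J" and h: "finite_sequence s h"
  shows "unimodal s h" "O_sequence TYPE('k) h" "O_sequence TYPE('k) (pos_diff h)"
proof -
  have J: "ideal J (polys V)" using hJ by (simp add: homogeneous_ideal_def)
  have h0: "h 0 = 1" using h by (simp add: finite_sequence_def)
  \<comment> \<open>The unit ideal would contain all forms of degree 0 and so have Hilbert function
    0 there.\<close>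
  have proper: "I \<noteq> carrier (polys V)" if I: "ideal I (polys V)" "hilbert_function V I 0 = 1" for I :: "'k mpoly set"
    using hilbert_function_eq_0_iff[OF V I(1), of 0] I(2) forms_carrier by force
  show "O_sequence TYPE('k) h"
    unfolding O_sequence_def using V hJ hf proper[OF J] h0 by blast
  obtain g where g: "g \<in> forms V 1"
    and rk: "\<And>i. K.rdim J ((*) g ` forms V i) = min (h i) (h (i + 1))"
    using wl hf unfolding weak_lefschetz_rdim[OF J V] by blast
  define J' where "J' = {a + g * b |a b. a \<in> J \<and> b \<in> carrier (polys V)}"
  note adj = adjoin_linear_form[OF V hJ g, folded J'_def]
  have J': "ideal J' (polys V)" using adj(1) by (simp add: homogeneous_ideal_def)
  \<comment> \<open>Maximal rank makes the drop equal to \<open>min (h i) (h (i + 1))\<close>;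
    subtracting it from \<open>h (i + 1)\<close> leaves the positive part of the difference.\<close>
  have pd: "hilbert_function V J' t = pos_diff h t" for t
  proof (cases t)
    case 0
    then show ?thesis using adj(2) hf by (simp add: pos_diff_def)
  next
    case (Suc i)
    then show ?thesis using adj(3)[of i] rk hf by (simp add: pos_diff_def)
  qed
  show "O_sequence TYPE('k) (pos_diff h)"
    unfolding O_sequence_def
    using V adj(1) proper[OF J'] pd h0 by (intro exI[of _ V] exI[of _ J']) (auto simp: pos_diff_def)
  \<comment> \<open>No growth at step \<open>i\<close> means that the quotient by \<open>J'\<close>
    vanishes in degree \<open>Suc i\<close>, and then also in the next degree.\<close>
  have next_le: "h (Suc (Suc i)) \<le> h (Suc i)" if "h (Suc i) \<le> h i" for i
  proof -
    have "forms V (Suc i) \<subseteq> J'"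
      using hilbert_function_eq_0_iff[OF V J', of "Suc i"] pd[of "Suc i"] that by (simp add: pos_diff_def)
    then have "forms V (Suc (Suc i)) \<subseteq> J'" by (rule forms_Suc_subset[OF J'])
    then show ?thesis
      using hilbert_function_eq_0_iff[OF V J', of "Suc (Suc i)"] pd[of "Suc (Suc i)"] by (simp add: pos_diff_def)
  qed
  \<comment> \<open>The first step without growth; there is one no later than \<open>s\<close>,
    where the sequence falls to 0.\<close>
  define k where "k = (LEAST i. h (Suc i) \<le> h i)"
  have s: "h (Suc s) \<le> h s" using h by (simp add: finite_sequence_def)
  have k: "h (Suc k) \<le> h k" "k \<le> s"
    unfolding k_def using LeastI[of "\<lambda>i. h (Suc i) \<le> h i", OF s] Least_le[of "\<lambda>i. h (Suc i) \<le> h i", OF s] by simp_all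
  have up: "h i \<le> h (Suc i)" if "i < k" for i
    using not_less_Least[of i "\<lambda>i. h (Suc i) \<le> h i"] that by (simp add: k_def)
  have down: "h (Suc i) \<le> h i" if "k \<le> i" for i
    using that by (induction i rule: dec_induct) (auto simp: k next_le)
  have "mono_on {..k} h"
  proof (rule mono_onI)
    fix r t assume "r \<in> {..k}" "t \<in> {..k}" "r \<le> t"
    from \<open>r \<le> t\<close> \<open>t \<in> {..k}\<close> show "h r \<le> h t"
      by (induction t rule: dec_induct) (auto intro: order_trans[OF _ up])
  qed
  moreover have "antimono_on {k..s} h"
  proof (rule monotone_onI)
    fix r t assume "r \<in> {k..s}" "t \<in> {k..s}" "r \<le> t"
    from \<open>r \<le> t\<close> \<open>r \<in> {k..s}\<close> show "h t \<le> h r"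
      by (induction t rule: dec_induct) (auto intro: order_trans[OF down])
  qed
  ultimately show "unimodal s h" unfolding unimodal_def using k by blast
qed

lemma sequences_imp_lefschetz:
  fixes h :: "nat \<Rightarrow> nat"
  assumes h: "finite_sequence s h" and u: "unimodal s h" and o: "O_sequence TYPE('k::field) (pos_diff h)"
  shows "\<exists>V (J :: 'k mpoly set). finite V \<and> homogeneous_artinian_ideal V J
    \<and> hilbert_function V J = h \<and> weak_lefschetz V J"
proof -
  obtain k where k: "k \<le> s" "mono_on {..k} h" "antimono_on {k..s} h"
    using u unfolding unimodal_def by blast
  obtain W and J :: "'k mpoly set" where W: "finite W" and hJ: "homogeneous_ideal W J"
    and hf: "hilbert_function W J = pos_diff h"
    using o unfolding O_sequence_def by blast
  have J: "ideal J (polys W)" using hJ by (simp add: homogeneous_ideal_def)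
  have inc: "h t \<le> h (t + 1)" if "t < k" for t
    using that mono_onD[OF k(2), of t "t + 1"] by simp
  \<comment> \<open>The descent continues past \<open>s\<close>, where the sequence is 0.\<close>
  have anti: "h t \<le> h r" if "k \<le> r" "r \<le> t" for r t
    using that monotone_onD[OF k(3), of r t] h by (cases "t \<le> s") (auto simp: finite_sequence_def)
  have high: "forms W t \<subseteq> J" if "t > k" for t
    using that anti[of "t - 1" t] hilbert_function_eq_0_iff[OF W J, of t] hf
    by (cases t) (simp_all add: pos_diff_def)
  obtain E where "E 0 = J \<and> mono E \<and>
      (\<forall>i. ideal (E i) (polys W) \<and> K.rdim (E i) (lowdeg W k) = h k - i)"
    using ideal_chain_exists[OF W J high rdim_lowdeg_pos_diff[OF W hJ hf inc order_refl]] ..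
  then have E: "E 0 = J" "mono E" "\<And>i. ideal (E i) (polys W)"
    "\<And>i. K.rdim (E i) (lowdeg W k) = h k - i" by simp_all
  \<comment> \<open>\<open>E i\<close> has codimension \<open>h k - i\<close>, so the index
    \<open>h k - h t\<close> gives codimension \<open>h t\<close>; past \<open>s\<close> this is 0
    and \<open>D t\<close> contains all of \<open>lowdeg W k\<close>.\<close>
  define D where "D t = E (if t \<le> k then 0 else h k - h t)" for t
  have mD: "mono D"
    unfolding D_def by (intro monoI monoD[OF E(2)]) (use anti in \<open>auto intro: diff_le_mono2\<close>)
  \<comment> \<open>The Lefschetz element will be a fresh variable.\<close>
  obtain v where v: "v \<notin> W" using ex_new_if_finite[OF infinite_UNIV_nat W] by blast
  have iD: "ideal (D t) (polys W)" for t unfolding D_def by (rule E(3))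
  have Dk: "D t = D 0" if "t \<le> k" for t using that by (simp add: D_def)
  have DJ: "D 0 = J" by (simp add: D_def E(1))
  have top: "K.rdim (D t) (lowdeg W k) = h t" if "t > k" for t
    using that anti[of k t] by (simp add: D_def E(4))
  have dec: "h (t + 1) \<le> h t" if "k \<le> t" for t using anti[OF that, of "t + 1"] by simp
  note core = v W iD mD hJ[folded DJ] Dk hf[folded DJ] top inc dec
  have "h t = 0" if "t > s" for t using h that by (simp add: finite_sequence_def)
  then have "homogeneous_artinian_ideal (insert v W) (stacked_ideal v W D)"
    using stacked_ideal_artinian[OF core] by blast
  then show ?thesis
    using finite.insertI[OF W, of v] stacked_ideal_hilbert[OF core] stacked_ideal_lefschetz[OF core]
    by (intro exI[of _ "insert v W"] exI[of _ "stacked_ideal v W D"] conjI)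
qed

section \<open>The constructed ideal\<close>

lemma carrier_polys_mono: "V \<subseteq> V' \<Longrightarrow> carrier (polys V) \<subseteq> carrier (polys V')"
  unfolding carrier_polys by (intro supported_mono) (auto simp: monoms_def)

lemma Idl_polys:
  fixes J :: "'k::field mpoly set"
  assumes "J \<subseteq> carrier (polys V)"
  shows "ideal (Idl\<^bsub>polys V\<^esub> J) (polys V)" "J \<subseteq> Idl\<^bsub>polys V\<^esub> J"
    "\<And>I. ideal I (polys V) \<Longrightarrow> J \<subseteq> I \<Longrightarrow> Idl\<^bsub>polys V\<^esub> J \<subseteq> I"
  by (rule ring.genideal_ideal[OF ring_polys assms], rule ring.genideal_self[OF ring_polys assms],
      rule ring.genideal_minimal[OF ring_polys])

lemma irrelevant_ideal_ideal: "ideal (irrelevant_ideal V :: 'k::field mpoly set) (polys V)"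
  unfolding irrelevant_ideal_def by (rule Idl_polys) (auto intro: var_carrier)

text \<open>The polynomials without constant term form an ideal containing the variables.\<close>

lemma irrelevant_ideal_supported:
  "irrelevant_ideal V \<subseteq> (supported {m \<in> monoms V. 1 \<le> mdeg m} :: 'k::field mpoly set)"
  unfolding irrelevant_ideal_def
proof (rule Idl_polys(3))
  let ?S = "supported {m \<in> monoms V. 1 \<le> mdeg m} :: 'k mpoly set"
  show "(var ` V :: 'k mpoly set) \<subseteq> carrier (polys V)" by (auto intro: var_carrier)
  show "(var ` V :: 'k mpoly set) \<subseteq> ?S"
    by (auto simp: var_def intro!: single_supported)
  show "ideal ?S (polys V)"
  proof (rule ideal_polysI)
    show "?S \<subseteq> carrier (polys V)" unfolding carrier_polys by (intro supported_mono) auto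
    show "r * a \<in> ?S" if "r \<in> carrier (polys V)" "a \<in> ?S" for r a
      using that unfolding carrier_polys by (rule supported_mult) (auto intro: monoms_add simp: mdeg_add)
  qed (use K.subspace_0 K.subspace_add subspace_supported in blast)+
qed

section \<open>Sums and powers in the semiring of ideals\<close>

lemma ideals_set_simps [simp]:
  "carrier (ideals_set R) = {I. ideal I R}" "x \<otimes>\<^bsub>ideals_set R\<^esub> y = x \<cdot>\<^bsub>R\<^esub> y"
  "\<one>\<^bsub>ideals_set R\<^esub> = carrier R" "\<zero>\<^bsub>ideals_set R\<^esub> = {\<zero>\<^bsub>R\<^esub>}" "x \<oplus>\<^bsub>ideals_set R\<^esub> y = x <+>\<^bsub>R\<^esub> y"
  by (simp_all add: ideals_set_def)

lemma semiring_ideals_polys: "semiring (ideals_set (polys V :: 'k::field mpoly ring))"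
  by (rule cring.ideals_set_is_semiring[OF cring_polys])

lemma ideal_add_polys:
  fixes I J :: "'k::field mpoly set"
  assumes "ideal I (polys V)" "ideal J (polys V)"
  shows "ideal (I <+>\<^bsub>polys V\<^esub> J) (polys V)" "I \<subseteq> I <+>\<^bsub>polys V\<^esub> J" "J \<subseteq> I <+>\<^bsub>polys V\<^esub> J"
    "\<And>L. ideal L (polys V) \<Longrightarrow> I \<subseteq> L \<Longrightarrow> J \<subseteq> L \<Longrightarrow> I <+>\<^bsub>polys V\<^esub> J \<subseteq> L"
proof -
  show "ideal (I <+>\<^bsub>polys V\<^esub> J) (polys V)" by (rule ring.add_ideals[OF ring_polys assms])
  show "I \<subseteq> I <+>\<^bsub>polys V\<^esub> J" "J \<subseteq> I <+>\<^bsub>polys V\<^esub> J"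
    using ideal_polysD(2)[OF assms(1)] ideal_polysD(2)[OF assms(2)] by (force simp: set_add_def')+
  show "I <+>\<^bsub>polys V\<^esub> J \<subseteq> L" if "ideal L (polys V)" "I \<subseteq> L" "J \<subseteq> L" for L
    using that ideal_polysD(3)[OF that(1)] by (auto simp: set_add_def')
qed

text \<open>The sum is characterized as the least ideal containing all summands; the comparison with
  the stacked ideal works through these inclusions.\<close>

lemma finsum_ideals_polys:
  fixes F :: "'i \<Rightarrow> 'k::field mpoly set"
  assumes "finite A" "\<And>i. i \<in> A \<Longrightarrow> ideal (F i) (polys V)"
  shows "ideal (finsum (ideals_set (polys V)) F A) (polys V)
    \<and> (\<forall>i\<in>A. F i \<subseteq> finsum (ideals_set (polys V)) F A)
    \<and> (\<forall>L. ideal L (polys V) \<longrightarrow> (\<forall>i\<in>A. F i \<subseteq> L) \<longrightarrow> finsum (ideals_set (polys V)) F A \<subseteq> L)"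
  using assms
proof (induction A)
  case empty
  interpret S: semiring "ideals_set (polys V :: 'k mpoly ring)" by (rule semiring_ideals_polys)
  have "ideal {0 :: 'k mpoly} (polys V)"
    using K.subspace_0[OF carrier_subspace] by (intro ideal_polysI) auto
  then show ?case using ideal_polysD(2) by auto
next
  case (insert a A)
  interpret S: semiring "ideals_set (polys V :: 'k mpoly ring)" by (rule semiring_ideals_polys)
  have IH: "ideal (finsum (ideals_set (polys V)) F A) (polys V)"
    "\<And>i. i \<in> A \<Longrightarrow> F i \<subseteq> finsum (ideals_set (polys V)) F A"
    "\<And>L. ideal L (polys V) \<Longrightarrow> (\<And>i. i \<in> A \<Longrightarrow> F i \<subseteq> L) \<Longrightarrow> finsum (ideals_set (polys V)) F A \<subseteq> L"
    using insert by auto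
  have Fa: "ideal (F a) (polys V)" using insert.prems by simp
  have eq: "finsum (ideals_set (polys V)) F (insert a A)
      = F a <+>\<^bsub>polys V\<^esub> finsum (ideals_set (polys V)) F A"
    using insert by (subst S.finsum_insert) auto
  note add = ideal_add_polys[OF Fa IH(1)]
  show ?case unfolding eq
  proof (intro conjI ballI allI impI add(1))
    show "F i \<subseteq> F a <+>\<^bsub>polys V\<^esub> finsum (ideals_set (polys V)) F A" if "i \<in> insert a A" for i
      using that add(2,3) IH(2) by blast
    show "F a <+>\<^bsub>polys V\<^esub> finsum (ideals_set (polys V)) F A \<subseteq> L"
      if "ideal L (polys V)" "\<forall>i\<in>insert a A. F i \<subseteq> L" for L
      using that by (intro add(4) IH(3)) auto
  qed
qed

lemma irrelevant_power_Suc: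
  "irrelevant_ideal V [^]\<^bsub>ideals_set (polys V)\<^esub> Suc n
    = (irrelevant_ideal V [^]\<^bsub>ideals_set (polys V)\<^esub> n) \<cdot>\<^bsub>polys V\<^esub> (irrelevant_ideal V :: 'k::field mpoly set)"
proof -
  interpret S: semiring "ideals_set (polys V :: 'k mpoly ring)" by (rule semiring_ideals_polys)
  show ?thesis by simp
qed

lemma irrelevant_power_0:
  "irrelevant_ideal V [^]\<^bsub>ideals_set (polys V)\<^esub> (0 :: nat) = carrier (polys V :: 'k::field mpoly ring)"
proof -
  interpret S: semiring "ideals_set (polys V :: 'k mpoly ring)" by (rule semiring_ideals_polys)
  show ?thesis by simp
qed

lemma irrelevant_power_ideal:
  "ideal (irrelevant_ideal V [^]\<^bsub>ideals_set (polys V)\<^esub> (n :: nat)) (polys V :: 'k::field mpoly ring)"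
proof (induction n)
  case 0
  show ?case unfolding irrelevant_power_0 by (rule ring.oneideal[OF ring_polys])
next
  case (Suc n)
  then show ?case unfolding irrelevant_power_Suc
    by (rule ring.ideal_prod_is_ideal[OF ring_polys _ irrelevant_ideal_ideal])
qed

text \<open>With \<open>forms_irrelevant_power\<close> this pins the power down: it lives in degrees
  at least \<open>n\<close> and contains every form of such a degree.\<close>

lemma irrelevant_power_supported:
  "irrelevant_ideal V [^]\<^bsub>ideals_set (polys V)\<^esub> (n :: nat)
    \<subseteq> (supported {m \<in> monoms V. n \<le> mdeg m} :: 'k::field mpoly set)"
proof (induction n)
  case 0
  show ?case unfolding irrelevant_power_0 carrier_polys by simp
next
  case (Suc n)
  show ?case
  proof
    fix x :: "'k mpoly" assume "x \<in> irrelevant_ideal V [^]\<^bsub>ideals_set (polys V)\<^esub> Suc n"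
    then show "x \<in> (supported {m \<in> monoms V. Suc n \<le> mdeg m} :: 'k mpoly set)"
      unfolding irrelevant_power_Suc
    proof (induction x rule: ideal_prod.induct)
      case (prod i j)
      then have "i \<in> supported {m \<in> monoms V. n \<le> mdeg m}" "j \<in> supported {m \<in> monoms V. 1 \<le> mdeg m}"
        using Suc irrelevant_ideal_supported by blast+
      then show ?case unfolding polys_simps
        by (rule supported_mult) (auto intro: monoms_add simp: mdeg_add)
    next
      case (sum s1 s2)
      then show ?case using K.subspace_add[OF subspace_supported] by simp
    qed
  qed
qed

text \<open>Each induction step splits off one variable, which supplies one factor of the
  power.\<close>

lemma single_irrelevant_power:
  assumes "m \<in> monoms V" "n \<le> mdeg m"
  shows "(Poly_Mapping.single m 1 :: 'k::field mpoly) \<in> irrelevant_ideal V [^]\<^bsub>ideals_set (polys V)\<^esub> (n :: nat)"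
  using assms
proof (induction n arbitrary: m)
  case 0
  then show ?case unfolding irrelevant_power_0 carrier_polys by (intro single_supported)
next
  case (Suc n)
  then obtain t where "mdeg m = Suc t" by (cases "mdeg m") auto
  then obtain i m' where m: "i \<in> V" "m' \<in> monoms V" "mdeg m' = t" "m = Poly_Mapping.single i 1 + m'"
    using monom_split[OF Suc.prems(1)] by blast
  have "(Poly_Mapping.single m' 1 :: 'k mpoly) \<in> irrelevant_ideal V [^]\<^bsub>ideals_set (polys V)\<^esub> n"
    using Suc m \<open>mdeg m = Suc t\<close> by simp
  moreover have "(var i :: 'k mpoly) \<in> irrelevant_ideal V"
    unfolding irrelevant_ideal_def using Idl_polys(2)[of "var ` V" V] var_carrier m(1) by blast
  ultimately have "Poly_Mapping.single m' 1 \<otimes>\<^bsub>polys V\<^esub> (var i :: 'k mpoly)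
      \<in> irrelevant_ideal V [^]\<^bsub>ideals_set (polys V)\<^esub> Suc n"
    unfolding irrelevant_power_Suc by (rule ideal_prod.prod)
  then show ?case by (simp add: var_def mult_single m(4) add.commute)
qed

lemma forms_irrelevant_power:
  assumes "n \<le> t"
  shows "(forms V t :: 'k::field mpoly set) \<subseteq> irrelevant_ideal V [^]\<^bsub>ideals_set (polys V)\<^esub> (n :: nat)"
  unfolding forms_supported supported_span
  using assms
  by (intro K.span_minimal ideal_subspace[OF irrelevant_power_ideal])
    (auto intro: single_irrelevant_power)

text \<open>Components of a polynomial over \<open>V\<close> are automatically forms, and 0 lies in
  \<open>J\<close>, so the case distinction splits into two independent conditions.\<close>

lemma ideal_from_degree_iff:
  assumes "ideal J (polys V)"
  shows "p \<in> ideal_from_degree V J u \<longleftrightarrow>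
    p \<in> carrier (polys V) \<and> (\<forall>t. hcomp t p \<in> J) \<and> (\<forall>t<u. hcomp t p = 0)"
  unfolding ideal_from_degree_def
  using hcomp_forms[of p V] ideal_polysD(2)[OF assms] by (auto split: if_splits) (metis not_le)

lemma ideal_from_degree_ideal:
  fixes J :: "'k::field mpoly set"
  assumes J: "ideal J (polys V)"
  shows "ideal (ideal_from_degree V J u) (polys V)"
proof (rule ideal_polysI)
  note iff = ideal_from_degree_iff[OF J]
  show "ideal_from_degree V J u \<subseteq> carrier (polys V)" by (auto simp: ideal_from_degree_def)
  show "0 \<in> ideal_from_degree V J u"
    by (simp add: iff K.subspace_0[OF carrier_subspace] ideal_polysD(2)[OF J])
  show "a + b \<in> ideal_from_degree V J u" if "a \<in> ideal_from_degree V J u" "b \<in> ideal_from_degree V J u" for a b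
    using that by (simp add: iff K.subspace_add[OF carrier_subspace] hcomp_add ideal_polysD(3)[OF J])
  show "r * a \<in> ideal_from_degree V J u" if r: "r \<in> carrier (polys V)" and a: "a \<in> ideal_from_degree V J u" for r a
  proof -
    have "hcomp t (r * a) \<in> J" for t
      unfolding hcomp_mult
      using a ideal_polysD(4)[OF J subsetD[OF forms_carrier hcomp_forms[OF r]]]
      by (intro K.subspace_sum[OF ideal_subspace[OF J]]) (simp add: iff)
    \<comment> \<open>Every summand contains a component of \<open>a\<close> of degree at most
      \<open>t\<close>, hence below \<open>u\<close>, which is 0.\<close>
    moreover have "hcomp t (r * a) = 0" if "t < u" for t
      unfolding hcomp_mult using a that by (intro sum.neutral) (auto simp: iff)
    ultimately show ?thesis using a polys_mult_closed[OF r] by (simp add: iff)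
  qed
qed

lemma homogeneous_idealD:
  assumes "homogeneous_ideal V J"
  shows "ideal J (polys V)" "p \<in> J \<Longrightarrow> hcomp t p \<in> J"
  using assms by (auto simp: homogeneous_ideal_def)

section \<open>Extension of a homogeneous ideal to one more variable\<close>

context
  fixes v :: nat and W :: "nat set" and J :: "'k::field mpoly set"
  assumes v: "v \<notin> W" and hJ: "homogeneous_ideal W J"
begin

private lemmas J_ideal = homogeneous_idealD(1)[OF hJ] and J_hcomp = homogeneous_idealD(2)[OF hJ]

lemma J_carrier: "J \<subseteq> carrier (polys (insert v W))"
  using ideal_polysD(1)[OF J_ideal] carrier_polys_mono[of W "insert v W"] by blast

text \<open>The preimage of \<open>J\<close> under \<open>dehom v\<close> is an ideal, and it
  contains \<open>J\<close> because \<open>dehom v\<close> fixes polynomials without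
  \<open>v\<close>.\<close>

lemma extension_dehom:
  assumes "p \<in> Idl\<^bsub>polys (insert v W)\<^esub> J" shows "dehom v p \<in> J"
proof -
  let ?A = "{p \<in> carrier (polys (insert v W)). dehom v p \<in> J}"
  have "ideal ?A (polys (insert v W))"
  proof (rule ideal_polysI)
    show "0 \<in> ?A" using K.subspace_0[OF carrier_subspace] ideal_polysD(2)[OF J_ideal] by simp
    show "a + b \<in> ?A" if "a \<in> ?A" "b \<in> ?A" for a b
      using that by (simp add: dehom_add K.subspace_add[OF carrier_subspace] ideal_polysD(3)[OF J_ideal])
    show "r * a \<in> ?A" if "r \<in> carrier (polys (insert v W))" "a \<in> ?A" for r a
      using that by (simp add: dehom_mult polys_mult_closed ideal_polysD(4)[OF J_ideal] dehom_carrier)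
  qed blast
  moreover have "J \<subseteq> ?A"
    using J_carrier by (auto simp: dehom_id[OF subsetD[OF ideal_polysD(1)[OF J_ideal]] v])
  ultimately have "Idl\<^bsub>polys (insert v W)\<^esub> J \<subseteq> ?A" by (rule Idl_polys(3)[OF J_carrier])
  then show ?thesis using assms by blast
qed

lemma homog_form:
  assumes "g \<in> forms W j"
  shows "homog v t g = Poly_Mapping.single (Poly_Mapping.single v (t - j)) 1 * g"
proof (rule linear_eq_supported[OF linear_homog linear_mult _ assms[unfolded forms_supported]])
  fix m assume "m \<in> {m \<in> monoms W. mdeg m = j}"
  then show "homog v t (Poly_Mapping.single m 1)
      = Poly_Mapping.single (Poly_Mapping.single v (t - j)) 1 * Poly_Mapping.single m 1"
    by (simp add: homog_single mult_single add.commute)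
qed

text \<open>A form is recovered as the sum of the components of its dehomogenization, each times a
  power of \<open>v\<close>. These components lie in \<open>J\<close> since \<open>J\<close> is
  homogeneous.\<close>

lemma form_in_extension:
  assumes f: "f \<in> forms (insert v W) t" and d: "dehom v f \<in> J"
  shows "f \<in> Idl\<^bsub>polys (insert v W)\<^esub> J"
proof -
  let ?I = "Idl\<^bsub>polys (insert v W)\<^esub> J"
  note I = Idl_polys[OF J_carrier]
  let ?q = "dehom v f"
  interpret vector_space_pair scal scal by unfold_locales
  have "?q = (\<Sum>j\<le>t. hcomp j ?q)"
    by (rule lowdeg_decomposition[OF dehom_form_lowdeg[OF v f]])
  then have "f = homog v t (\<Sum>j\<le>t. hcomp j ?q)" using homog_dehom[OF v f] by simp
  also have "\<dots> = (\<Sum>j\<le>t. homog v t (hcomp j ?q))" by (rule linear_sum[OF linear_homog])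
  also have "\<dots> \<in> ?I"
  proof (rule K.subspace_sum[OF ideal_subspace[OF I(1)]])
    fix j
    have "hcomp j ?q \<in> forms W j"
      by (rule hcomp_forms[OF subsetD[OF ideal_polysD(1)[OF J_ideal] d]])
    moreover have "Poly_Mapping.single (Poly_Mapping.single v (t - j)) 1
        \<in> carrier (polys (insert v W) :: 'k mpoly ring)"
      unfolding carrier_polys by (intro single_supported) simp
    ultimately show "homog v t (hcomp j ?q) \<in> ?I"
      using homog_form[of "hcomp j ?q" j t] ideal_polysD(4)[OF I(1)] subsetD[OF I(2) J_hcomp[OF d, of j]]
      by simp
  qed
  finally show ?thesis .
qed

end

text \<open>The index of the plateau containing \<open>t\<close>. The inserted 1 assigns the growing
  range before \<open>u 1\<close> to the first plateau, matching the fact that the first ideal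
  serves all these degrees.\<close>

definition plateau :: "nat \<Rightarrow> (nat \<Rightarrow> nat) \<Rightarrow> nat \<Rightarrow> nat" where
  "plateau l u t = Max (insert 1 {i \<in> {2..l}. u i \<le> t})"

lemma plateau_props:
  assumes "1 \<le> l"
  shows "1 \<le> plateau l u t" "plateau l u t \<le> l"
    "plateau l u t \<noteq> 1 \<Longrightarrow> u (plateau l u t) \<le> t"
    "i \<in> {2..l} \<Longrightarrow> u i \<le> t \<Longrightarrow> i \<le> plateau l u t"
proof -
  have "plateau l u t \<in> insert 1 {i \<in> {2..l}. u i \<le> t}" unfolding plateau_def by (rule Max_in) auto
  then show "1 \<le> plateau l u t" "plateau l u t \<le> l" "plateau l u t \<noteq> 1 \<Longrightarrow> u (plateau l u t) \<le> t"
    using assms by auto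
  show "i \<in> {2..l} \<Longrightarrow> u i \<le> t \<Longrightarrow> i \<le> plateau l u t"
    unfolding plateau_def by (rule Max_ge) auto
qed

lemma plateau_mono: "t \<le> t' \<Longrightarrow> plateau l u t \<le> plateau l u t'"
  unfolding plateau_def by (rule Max_mono) auto

section \<open>The construction for a given sequence and chain of ideals\<close>

context
  fixes h :: "nat \<Rightarrow> nat" and s n l :: nat and u :: "nat \<Rightarrow> nat" and Jb :: "nat \<Rightarrow> 'k::field mpoly set"
  assumes h: "finite_sequence s h" and pl: "plateau_indices s h l u" and ch: "ideal_chain n h l u Jb"
begin

private abbreviation "W \<equiv> {1..n}"

text \<open>The whole ring beyond \<open>s\<close> accounts for the summand given by the power
  \<open>s + 1\<close> of the irrelevant ideal.\<close>

private definition "D t = (if s < t then carrier (polys W) else Jb (plateau l u t))"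

private lemma l1: "1 \<le> l" and ul: "u l \<le> s"
  using pl by (auto simp: plateau_indices_def)

private lemma u_less: "1 \<le> i \<Longrightarrow> i < j \<Longrightarrow> j \<le> l \<Longrightarrow> u i < u j"
proof (induction j)
  case (Suc j)
  have "u j < u (j + 1)" using pl Suc.prems by (auto simp: plateau_indices_def)
  then show ?case using Suc by (cases "i = j") auto
qed simp

private lemma u1_s: "u 1 \<le> s"
  using u_less[of 1 l] l1 ul by (cases "l = 1") auto

text \<open>A larger index \<open>i\<close> would satisfy \<open>u i \<le> t \<le> u 1\<close>,
  against the strict growth of \<open>u\<close>. The case \<open>t = u 1\<close> is included so that
  the family is constant up to the peak itself.\<close>

private lemma plateau_eq_1: "t \<le> u 1 \<Longrightarrow> plateau l u t = 1"
  using plateau_props(1,2,3)[OF l1, of u t] u_less[of 1 "plateau l u t"] by force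

private lemma u_plateau: "u 1 \<le> t \<Longrightarrow> u (plateau l u t) \<le> t"
  using plateau_props(3)[OF l1, of u t] by (cases "plateau l u t = 1") auto

private lemma less_u_Suc_plateau: "plateau l u t < l \<Longrightarrow> t < u (plateau l u t + 1)"
  using plateau_props(4)[OF l1, of "plateau l u t + 1" u t] plateau_props(1)[OF l1, of u t] by force

private lemma h_last: "j \<in> {u l..s} \<Longrightarrow> h j = h (u l)"
  using pl unfolding plateau_indices_def by blast

private lemma h_constant:
  "i \<in> {1..<l} \<Longrightarrow> j \<in> {u i..u (i + 1) - 1} \<Longrightarrow> h j = h (u i)"
  using pl unfolding plateau_indices_def by blast

private lemma h_drop: "i \<in> {1..<l} \<Longrightarrow> h (u (i + 1) - 1) > h (u (i + 1))"
  using pl unfolding plateau_indices_def by blast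

private lemma h_plateau:
  assumes "u 1 \<le> t" "t \<le> s" shows "h t = h (u (plateau l u t))"
proof (cases "plateau l u t = l")
  case True
  then show ?thesis using u_plateau[OF assms(1)] assms(2) h_last[of t] by simp
next
  case False
  then have lt: "plateau l u t < l" using plateau_props(2)[OF l1, of u t] by simp
  show ?thesis
    by (rule h_constant)
      (use lt plateau_props(1)[OF l1, of u t] u_plateau[OF assms(1)] less_u_Suc_plateau[OF lt] in auto)
qed

private lemma h_inc: "t < u 1 \<Longrightarrow> h t < h (t + 1)"
  using pl by (simp add: plateau_indices_def)

private lemma h_dec:
  assumes t: "u 1 \<le> t" shows "h (t + 1) \<le> h t"
proof (cases "t < s")
  case False
  then show ?thesis using h by (simp add: finite_sequence_def)
next
  case True
  let ?i = "plateau l u t"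
  have ht: "h t = h (u ?i)" using h_plateau[OF t] True by simp
  have ui: "u ?i \<le> t" using u_plateau[OF t] .
  have i: "1 \<le> ?i" "?i \<le> l" using plateau_props[OF l1] by auto
  show ?thesis
  proof (cases "?i = l")
    case True
    then have "h (t + 1) = h (u ?i)" using ui \<open>t < s\<close> h_last[of "t + 1"] by simp
    then show ?thesis using ht by simp
  next
    case False
    then have lt: "?i < l" using i by simp
    have il: "?i \<in> {1..<l}" using lt i by simp
    show ?thesis
    proof (cases "t + 1 = u (?i + 1)")
      \<comment> \<open>Here \<open>t\<close> ends its plateau, and the step to \<open>t + 1\<close>
        is the strict drop.\<close>
      case True
      then have "u (?i + 1) - 1 = t" by simp
      then show ?thesis using h_drop[OF il] True by simp
    next
      case False
      then have "t + 1 \<in> {u ?i..u (?i + 1) - 1}" using less_u_Suc_plateau[OF lt] ui by simp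
      then have "h (t + 1) = h (u ?i)" by (rule h_constant[OF il])
      then show ?thesis using ht by simp
    qed
  qed
qed

private lemma Jb_homogeneous: "i \<in> {1..l} \<Longrightarrow> homogeneous_ideal W (Jb i)"
  using ch by (simp add: ideal_chain_def homogeneous_artinian_ideal_def)

private lemma Jb_ideal: "i \<in> {1..l} \<Longrightarrow> ideal (Jb i) (polys W)"
  using Jb_homogeneous by (simp add: homogeneous_ideal_def)

private lemma Jb_mono: "1 \<le> i \<Longrightarrow> i \<le> j \<Longrightarrow> j \<le> l \<Longrightarrow> Jb i \<subseteq> Jb j"
proof (induction j)
  case (Suc j)
  show ?case
  proof (cases "i = Suc j")
    case False
    then have "Jb i \<subseteq> Jb j" "Jb j \<subseteq> Jb (j + 1)"
      using Suc ch by (auto simp: ideal_chain_def)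
    then show ?thesis by simp
  qed simp
qed simp

private lemma plateau_in: "plateau l u t \<in> {1..l}"
  using plateau_props[OF l1] by simp

private lemma D_ideal: "ideal (D t) (polys W)"
  unfolding D_def by (simp add: Jb_ideal[OF plateau_in] ring.oneideal[OF ring_polys] del: One_nat_def)

private lemma D_mono: "mono D"
proof (rule monoI)
  fix t t' :: nat assume "t \<le> t'"
  then show "D t \<subseteq> D t'"
    unfolding D_def using Jb_mono[OF _ plateau_mono] plateau_in ideal_polysD(1)[OF Jb_ideal[OF plateau_in]]
    by auto
qed

private lemma D_0: "D 0 = Jb 1"
  by (simp add: D_def plateau_eq_1)

private lemma D_low: "t \<le> u 1 \<Longrightarrow> D t = D 0"
  unfolding D_0 using u1_s by (simp add: D_def plateau_eq_1)

private lemma Jb1_hilbert: "hilbert_function W (Jb 1) = pos_diff h"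
  using ch by (simp add: ideal_chain_def)

private lemma Jb_high_forms:
  assumes "t > u 1" "i \<in> {1..l}" shows "forms W t \<subseteq> Jb i"
proof -
  have "pos_diff h t = 0" using h_dec[of "t - 1"] assms(1) by (cases t) (auto simp: pos_diff_def)
  then have "forms W t \<subseteq> Jb 1"
    using hilbert_function_eq_0_iff[OF _ Jb_ideal[of 1], of t] l1 Jb1_hilbert by simp
  then show ?thesis using Jb_mono[of 1 i] assms(2) by auto
qed

text \<open>On the first plateau the dimension comes from the Hilbert function of
  \<open>Jb 1\<close> by telescoping. On later ones it is the prescribed total dimension, since
  polynomials of degree at most \<open>u 1\<close> represent the whole quotient.\<close>

private lemma D_high:
  assumes t: "t > u 1" shows "K.rdim (D t) (lowdeg W (u 1)) = h t"
proof (cases "t \<le> s")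
  case False
  then have "D t = carrier (polys W)" by (simp add: D_def)
  then have "K.rdim (D t) (lowdeg W (u 1)) = 0"
    by (simp add: K.rdim_eq_0_iff findim_lowdeg carrier_subspace lowdeg_carrier)
  then show ?thesis using h False by (simp add: finite_sequence_def)
next
  case True
  let ?i = "plateau l u t"
  have Dt: "D t = Jb ?i" using True by (simp add: D_def)
  have ht: "h t = h (u ?i)" using h_plateau[of t] t True by simp
  show ?thesis
  proof (cases "?i = 1")
    case True
    have "homogeneous_ideal W (Jb 1)" using Jb_homogeneous[of 1] l1 by simp
    then have "K.rdim (Jb 1) (lowdeg W (u 1)) = h (u 1)"
      by (intro rdim_lowdeg_pos_diff[OF _ _ Jb1_hilbert less_imp_le[OF h_inc]]) auto
    then show ?thesis using Dt ht True by simp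
  next
    case False
    then have i: "?i \<in> {2..l}" using plateau_in[of t] by auto
    have J: "ideal (Jb ?i) (polys W)" using Jb_ideal[OF plateau_in] .
    have "kdim W (Jb ?i) (carrier (polys W Quot Jb ?i)) = K.rdim (Jb ?i) (lowdeg W (u 1))"
    proof (rule kdim_carrier[OF J findim_lowdeg lowdeg_carrier])
      show "\<exists>q\<in>lowdeg W (u 1). p - q \<in> Jb ?i" if "p \<in> carrier (polys W)" for p
        by (rule truncation[OF ideal_subspace[OF J] Jb_high_forms[OF _ plateau_in] that])
    qed simp
    moreover have "kdim W (Jb ?i) (carrier (polys W Quot Jb ?i)) = h (u ?i)"
      using ch i by (simp add: ideal_chain_def)
    ultimately show ?thesis using Dt ht by simp
  qed
qed

text \<open>One inclusion is checked on the summands. For the other, each homogeneous component of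
  an element of the stacked ideal falls into one summand, selected by its degree.\<close>

private lemma constructed_ideal_eq: "constructed_ideal n s l u Jb = stacked_ideal 0 W D"
proof -
  let ?V = "insert 0 W" and ?I = "stacked_ideal 0 W D"
  have V: "{0..n} = ?V" by auto
  have v: "0 \<notin> W" by simp
  have I: "ideal ?I (polys ?V)" using stacked_ideal_ideal[OF v _ D_ideal D_mono] by simp
  define J where "J i = Idl\<^bsub>polys ?V\<^esub> (Jb i)" for i
  define T where "T i = ideal_from_degree ?V (J i) (u i)" for i
  define S where "S = finsum (ideals_set (polys ?V)) T {2..l}"
  define M where "M = (irrelevant_ideal ?V :: 'k mpoly set) [^]\<^bsub>ideals_set (polys ?V)\<^esub> (s + 1)"
  have iJ: "ideal (J i) (polys ?V)" if "i \<in> {1..l}" for i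
    unfolding J_def by (rule Idl_polys(1)[OF J_carrier[OF v Jb_homogeneous[OF that]]])
  have iT: "ideal (T i) (polys ?V)" if "i \<in> {2..l}" for i
    unfolding T_def using that by (intro ideal_from_degree_ideal iJ) auto
  note fs = finsum_ideals_polys[of "{2..l}" T ?V, OF finite_atLeastAtMost iT, folded S_def]
  have iM: "ideal M (polys ?V)" unfolding M_def by (rule irrelevant_power_ideal)
  have J1: "ideal (J 1) (polys ?V)" using iJ l1 by simp
  have iS: "ideal S (polys ?V)" using fs by simp
  note add1 = ideal_add_polys[OF J1 iS]
  note add2 = ideal_add_polys[OF add1(1) iM]
  have C: "constructed_ideal n s l u Jb = (J 1 <+>\<^bsub>polys ?V\<^esub> S) <+>\<^bsub>polys ?V\<^esub> M"
    unfolding constructed_ideal_def Let_def V J_def T_def S_def M_def by simp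
  have "J 1 \<subseteq> ?I"
    unfolding J_def
  proof (rule Idl_polys(3)[OF J_carrier[OF v Jb_homogeneous] I])
    show "Jb 1 \<subseteq> ?I"
    proof
      fix p assume p: "p \<in> Jb 1"
      have h1: "homogeneous_ideal W (Jb 1)" using Jb_homogeneous l1 by simp
      \<comment> \<open>Elements of \<open>Jb 1\<close> do not involve the variable of index 0, so
        setting it to 1 changes nothing; and \<open>Jb 1\<close> is \<open>D 0\<close>, the least
        member of the family.\<close>
      have "dehom 0 (hcomp t p) \<in> D t" for t
      proof -
        have q: "hcomp t p \<in> Jb 1" using homogeneous_idealD(2)[OF h1 p] .
        then have "dehom 0 (hcomp t p) = hcomp t p"
          using subsetD[OF ideal_polysD(1)[OF homogeneous_idealD(1)[OF h1]]] by (intro dehom_id[OF _ v])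
        then show ?thesis using q monoD[OF D_mono, of 0 t] D_0 by auto
      qed
      then show "p \<in> ?I" using subsetD[OF J_carrier[OF v h1] p] by (simp add: stacked_ideal_def)
    qed
  qed (use l1 in auto)
  moreover have "T i \<subseteq> ?I" if i: "i \<in> {2..l}" for i
  proof
    fix p assume "p \<in> T i"
    moreover have i1: "i \<in> {1..l}" using i by simp
    ultimately have p: "p \<in> carrier (polys ?V)" "\<And>t. hcomp t p \<in> J i" "\<And>t. t < u i \<Longrightarrow> hcomp t p = 0"
      unfolding T_def ideal_from_degree_iff[OF iJ[OF i1]] by auto
    have "dehom 0 (hcomp t p) \<in> D t" for t
    proof (cases "t < u i")
      case True
      then show ?thesis using p(3) ideal_polysD(2)[OF D_ideal] by simp
    next
      case False
      have "dehom 0 (hcomp t p) \<in> Jb i"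
        using extension_dehom[OF v Jb_homogeneous[OF i1]] p(2) by (simp add: J_def)
      \<comment> \<open>From \<open>u i\<close> on, the plateau of \<open>t\<close> has index at
        least \<open>i\<close>; beyond \<open>s\<close> the ideal \<open>D t\<close> is
        everything.\<close>
      moreover have "Jb i \<subseteq> D t"
        unfolding D_def using ideal_polysD(1)[OF Jb_ideal[OF i1]] False i plateau_in[of t]
          Jb_mono[of i "plateau l u t"] plateau_props(4)[OF l1 i, of u t] by auto
      ultimately show ?thesis by blast
    qed
    then show "p \<in> ?I" using p(1) by (simp add: stacked_ideal_def)
  qed
  moreover have "M \<subseteq> ?I"
  proof
    fix p assume pM: "p \<in> M"
    then have pc: "p \<in> carrier (polys ?V)" using ideal_polysD(1)[OF iM] by blast
    have ps: "p \<in> supported {m \<in> monoms ?V. s + 1 \<le> mdeg m}"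
      using pM irrelevant_power_supported[of ?V "s + 1"] unfolding M_def by blast
    have "dehom 0 (hcomp t p) \<in> D t" for t
    proof (cases "t \<le> s")
      case True
      then have "hcomp t p = 0"
        using ps by (intro poly_mapping_eqI) (auto simp: lookup_hcomp supported_iff)
      then show ?thesis using ideal_polysD(2)[OF D_ideal] by simp
    next
      case False
      then show ?thesis
        using dehom_carrier[OF subsetD[OF forms_carrier hcomp_forms[OF pc]]] by (simp add: D_def)
    qed
    then show "p \<in> ?I" using pc by (simp add: stacked_ideal_def)
  qed
  moreover from calculation have "S \<subseteq> ?I" using fs I by blast
  ultimately have sub: "constructed_ideal n s l u Jb \<subseteq> ?I"
    unfolding C by (intro add2(4) add1(4) I)
  have CI: "ideal (constructed_ideal n s l u Jb) (polys ?V)" unfolding C by (rule add2(1))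
  have "J 1 \<subseteq> constructed_ideal n s l u Jb" "M \<subseteq> constructed_ideal n s l u Jb"
    unfolding C using add1(2) add2(2,3) by auto
  moreover have "T i \<subseteq> constructed_ideal n s l u Jb" if "i \<in> {2..l}" for i
    unfolding C using add1(3) add2(2) fs that by blast
  \<comment> \<open>Degrees above \<open>s\<close> go to the power of the irrelevant ideal, degrees
    of the first plateau and before to \<open>J 1\<close>, and degrees of a later plateau
    \<open>i\<close> to \<open>T i\<close>, whose truncation begins at \<open>u i\<close>.\<close>
  moreover have "hcomp t p \<in> J 1 \<or> (\<exists>i\<in>{2..l}. hcomp t p \<in> T i) \<or> hcomp t p \<in> M"
    if p: "p \<in> ?I" for p t
  proof -
    have pc: "p \<in> carrier (polys ?V)" using p by (simp add: stacked_ideal_def)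
    have f: "hcomp t p \<in> forms ?V t" by (rule hcomp_forms[OF pc])
    have d: "dehom 0 (hcomp t p) \<in> D t" using p by (simp add: stacked_ideal_def)
    show ?thesis
    proof (cases "t \<le> s")
      case False
      then show ?thesis using f forms_irrelevant_power[of "s + 1" t ?V] unfolding M_def by auto
    next
      case True
      let ?i = "plateau l u t"
      have "dehom 0 (hcomp t p) \<in> Jb ?i" using d True by (simp add: D_def)
      then have fJ: "hcomp t p \<in> J ?i"
        unfolding J_def using form_in_extension[OF v Jb_homogeneous[OF plateau_in] f] by blast
      show ?thesis
      proof (cases "?i = 1")
        case True
        then show ?thesis using fJ by simp
      next
        case False
        then have i: "?i \<in> {2..l}" "u ?i \<le> t" using plateau_in[of t] plateau_props(3)[OF l1, of u t] by auto
        have "hcomp t p \<in> T ?i"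
          unfolding T_def ideal_from_degree_iff[OF iJ[OF plateau_in]]
          using subsetD[OF forms_carrier f] fJ i(2) ideal_polysD(2)[OF iJ[OF plateau_in]]
          by (auto simp: hcomp_of_form[OF f])
        then show ?thesis using i(1) by blast
      qed
    qed
  qed
  ultimately have hin: "hcomp t p \<in> constructed_ideal n s l u Jb" if "p \<in> ?I" for p t
    using that by blast
  have "?I \<subseteq> constructed_ideal n s l u Jb"
  proof
    fix p assume p: "p \<in> ?I"
    then have "p \<in> carrier (polys ?V)" by (simp add: stacked_ideal_def)
    then obtain N where "p \<in> lowdeg ?V N" by (rule carrier_lowdeg)
    then have "p = (\<Sum>t\<le>N. hcomp t p)" by (rule lowdeg_decomposition)
    also have "\<dots> \<in> constructed_ideal n s l u Jb"
      using hin[OF p] by (intro K.subspace_sum[OF ideal_subspace[OF CI]])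
    finally show "p \<in> constructed_ideal n s l u Jb" .
  qed
  then show ?thesis using sub by blast
qed

lemma constructed_ideal_properties:
  shows "homogeneous_artinian_ideal {0..n} (constructed_ideal n s l u Jb)"
    "weak_lefschetz {0..n} (constructed_ideal n s l u Jb)"
    "hilbert_function {0..n} (constructed_ideal n s l u Jb) = h"
    "socle_type {0..n} (constructed_ideal n s l u Jb) = Phi s h (u 1)"
proof -
  have V: "{0..n} = insert 0 W" by auto
  have v: "0 \<notin> W" and fW: "finite W" by auto
  have D0: "homogeneous_ideal W (D 0)" unfolding D_0 using Jb_homogeneous l1 by simp
  note core = v fW D_ideal D_mono D0 D_low Jb1_hilbert[folded D_0] D_high less_imp_le[OF h_inc] h_dec
  have hs: "h t = 0" if "t > s" for t using h that by (simp add: finite_sequence_def)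
  show "homogeneous_artinian_ideal {0..n} (constructed_ideal n s l u Jb)"
    unfolding V constructed_ideal_eq using stacked_ideal_artinian[OF core hs] by blast
  show "weak_lefschetz {0..n} (constructed_ideal n s l u Jb)"
    unfolding V constructed_ideal_eq by (rule stacked_ideal_lefschetz[OF core])
  show "hilbert_function {0..n} (constructed_ideal n s l u Jb) = h"
    unfolding V constructed_ideal_eq by (rule stacked_ideal_hilbert[OF core])
  have sd: "socle_dim {0..n} (constructed_ideal n s l u Jb) t = h t - h (t + 1)" for t
    unfolding V constructed_ideal_eq by (rule stacked_ideal_socle[OF core])
  \<comment> \<open>Below \<open>u 1\<close> the sequence grows and the truncated difference is 0;
    past \<open>s\<close> it is 0 - 0.\<close>
  have "(\<Sum>i | h i - h (i + 1) \<noteq> 0. Polynomial.monom (int (h i - h (i + 1))) i)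
      = (\<Sum>i = u 1..s. Polynomial.monom (int (h i - h (i + 1))) i)"
  proof (rule sum.mono_neutral_left)
    show "{i. h i - h (i + 1) \<noteq> 0} \<subseteq> {u 1..s}"
    proof
      fix i assume "i \<in> {i. h i - h (i + 1) \<noteq> 0}"
      then show "i \<in> {u 1..s}" using h_inc[of i] hs[of i] by (cases "i < u 1"; cases "i > s") auto
    qed
  qed auto
  \<comment> \<open>From \<open>u 1\<close> on \<open>h\<close> does not grow, so truncated
    subtraction agrees with the integer difference in \<open>Phi\<close>.\<close>
  also have "\<dots> = Phi s h (u 1)"
    unfolding Phi_def using h_dec by (intro sum.cong) (auto simp: of_nat_diff)
  finally show "socle_type {0..n} (constructed_ideal n s l u Jb) = Phi s h (u 1)"
    unfolding socle_type_def sd .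
qed

end

theorem proposition3p5:
  fixes h :: "nat \<Rightarrow> nat" and s :: nat
  assumes "finite_sequence s h"
  shows
    "((\<exists>V (J :: 'k::field mpoly set).
         finite V \<and> homogeneous_artinian_ideal V J \<and> hilbert_function V J = h \<and> weak_lefschetz V J)
      \<longleftrightarrow> unimodal s h \<and> O_sequence TYPE('k) h \<and> O_sequence TYPE('k) (pos_diff h))
     \<and>
     (unimodal s h \<and> O_sequence TYPE('k) h \<and> O_sequence TYPE('k) (pos_diff h)
      \<longrightarrow> (\<forall>n l u (Jb :: nat \<Rightarrow> 'k mpoly set).
             h 1 \<le> n + 1 \<and> plateau_indices s h l u \<and> ideal_chain n h l u Jb
             \<longrightarrow> (let V = {0..n}; I = constructed_ideal n s l u Jb
                  in homogeneous_artinian_ideal V I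
                     \<and> weak_lefschetz V I
                     \<and> hilbert_function V I = h
                     \<and> socle_type V I = Phi s h (u 1))))"
proof (intro conjI iffI impI allI)
  assume "\<exists>V (J :: 'k mpoly set).
    finite V \<and> homogeneous_artinian_ideal V J \<and> hilbert_function V J = h \<and> weak_lefschetz V J"
  then obtain V and J :: "'k mpoly set" where "finite V" "homogeneous_ideal V J"
    "hilbert_function V J = h" "weak_lefschetz V J"
    by (auto simp: homogeneous_artinian_ideal_def)
  from lefschetz_imp_sequences[OF this assms]
  show "unimodal s h" "O_sequence TYPE('k) h" "O_sequence TYPE('k) (pos_diff h)" .
next
  assume "unimodal s h \<and> O_sequence TYPE('k) h \<and> O_sequence TYPE('k) (pos_diff h)"
  then show "\<exists>V (J :: 'k mpoly set).
    finite V \<and> homogeneous_artinian_ideal V J \<and> hilbert_function V J = h \<and> weak_lefschetz V J"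
    using sequences_imp_lefschetz[OF assms] by blast
next
  fix n l u and Jb :: "nat \<Rightarrow> 'k mpoly set"
  assume "h 1 \<le> n + 1 \<and> plateau_indices s h l u \<and> ideal_chain n h l u Jb"
  then show "let V = {0..n}; I = constructed_ideal n s l u Jb
    in homogeneous_artinian_ideal V I \<and> weak_lefschetz V I
      \<and> hilbert_function V I = h \<and> socle_type V I = Phi s h (u 1)"
    using constructed_ideal_properties[OF assms, of l u n Jb] unfolding Let_def by simp
qed

end
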